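(* There are polynomial-time separation algorithms for every one of the families (P), (T1)–(T5), (L0), (L1a), (L1b), (L2a)–(L2e) defined in the context. Given a point $\bar x\in\mathbb{R}^n$, the algorithm for each family identifies a member of that family violated by $\bar x$ whenever one exists. More specifically: (i) For $v=(1,\ldots,n)$, the family (P) can be separated in worst-case time $O(n\log n)$: order the indices $3,\ldots,n$ as $j_1,\ldots,j_{n-2}$ with $\bar x_{j_1}\le\cdots\le\bar x_{j_{n-2}}$, and check for successive $m$ whether $\sum_{i=1}^m \bar x_{j_i}<\frac12 m(m+1)$. If a violated member of (P) with $|J|=m$ exists, then the member with $J=\{j_1,\ldots,j_m\}$ is violated. (ii) The two-term families (T1)–(T4) can be separated in time $O(n)$. (iii) The inequalities (L0), (L1a) and (L2a) can be separated with the algorithms just described (they are members of (P) for $v=(1,\ldots,n)$). (iv) After a single initial sort of the values $\bar x_1,\ldots,\bar x_n$, for each fixed $m$ and each of the types (L1b), (L2b), (L2c), (L2d), (L2e), a violated inequality of that type with that $m$ can be identified, if one exists, in time $O(n)$. By enumerating the $O(n)$ values of $m$, the entire separation algorithm for levels 1 and 2 runs in time $O(n\log n+n^2)=O(n^2)$.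
   Context: Let $0\le v_1<\cdots<v_n$ and $v=(v_1,\ldots,v_n)$. The hamiltonian circuit polytope $H_n(v)$ is the convex hull of all $x=(x_1,\ldots,x_n)$ with $x_i\in\{v_1,\ldots,v_n\}$ such that the map sending $i$ to the index $k$ with $x_i=v_k$ is a single cycle through all of $1,\ldots,n$ (so $x_i$ names the vertex following vertex $i$ in a hamiltonian circuit of the complete directed graph). The separation problem for a family of facet-defining inequalities of this polytope is to find a member $ax\ge\alpha$ (or $ax\le\alpha$) of the family that is violated by the given point $x=\bar x$. Permutation family, for general $v$: (P) $\sum_{j\in J}x_j\ge\sum_{j=1}^{|J|}v_j$, for nonempty $J\subseteq\{3,\ldots,n\}$. For $v=(1,\ldots,n)$ the right-hand side is $\frac12|J|(|J|+1)$. Two-term families, for general $v$ and $n\ge6$: (T1) $x_i+x_j\ge v_1+v_2$, for distinct $i,j\in\{3,\ldots,n\}$. (T2) $(v_3-v_1)x_1+(v_3-v_2)x_2\ge v_3^2-v_1v_2$. (T3) $(v_2-v_1)x_2+(v_3-v_1)x_i\ge v_2v_3-v_1^2$, for $i\in\{3,\ldots,n\}$. (T4) $(v_{n-1}-v_{n-2})x_{n-1}+(v_n-v_{n-2})x_n\le v_nv_{n-1}-v_{n-2}^2$. (T5) $(v_n-v_{n-2})x_i+(v_n-v_{n-1})x_{n-1}\le v_n^2-v_{n-1}v_{n-2}$, for $i\in\{1,\ldots,n-2\}$. The remaining families are for $v=(1,\ldots,n)$. Level 0: (L0) $\sum_{j\in J}x_j\ge\frac12m(m+1)$, for $m=2,\ldots,n$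 and any $J\subseteq\{m+1,\ldots,n\}$ with $|J|=m$. Level 1, with $K\subseteq\{m+1,\ldots,n\}$, $|K|=m-1$, $n-m\ge4$: (L1a) $x_m+\sum_{j\in K}x_j\ge\frac12m(m+1)$, $m=3,\ldots,\lceil n/2\rceil$. (L1b) $x_m+2\sum_{j\in K}x_j\ge m^2+1$, $m=2,\ldots,\lceil n/2\rceil$. Level 2, with $L\subseteq\{m+1,\ldots,n\}$, $|L|=m-2$, $n-m\ge4$: (L2a) $x_{m-1}+x_m+\sum_{j\in L}x_j\ge\frac12m(m+1)$, $m=4,\ldots,\lceil(n+1)/2\rceil$. (L2b) $2x_{m-1}+x_m+2\sum_{j\in L}x_j\ge m^2+1$, $m=4,\ldots,\lceil(n+1)/2\rceil$. (L2c) $2x_{m-1}+x_m+4\sum_{j\in L}x_j\ge m(2m-3)+5$, $m=3,\ldots,\lceil(n+1)/2\rceil$. (L2d) $3x_{m-1}+2x_m+4\sum_{j\in L}x_j\ge m(2m-1)+4$, $m=3,\ldots,\lceil(n+1)/2\rceil$. (L2e) $3x_{m-1}+2x_m+5\sum_{j\in L}x_j\ge\frac52m(m-1)+6$, $m=3,\ldots,\lceil(n+1)/2\rceil$. *)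

theory Defs
  imports Complex_Main "HOL-Library.Landau_Symbols"
begin

section \<open>Inequalities and separation\<close>

datatype sense = Ge | Le

text \<open>Points and coefficient vectors are functions on \<^typ>\<open>nat\<close>; only the components
  with index in \<open>{1..n}\<close> matter, and coefficients of the families below vanish elsewhere.\<close>

datatype ineq = Ineq (coeffs: "nat \<Rightarrow> real") (sense_of: sense) (rhs: real)

definition lhs :: "nat \<Rightarrow> ineq \<Rightarrow> (nat \<Rightarrow> real) \<Rightarrow> real" where
  "lhs n I x = (\<Sum>i = 1..n. coeffs I i * x i)"

definition violated :: "nat \<Rightarrow> ineq \<Rightarrow> (nat \<Rightarrow> real) \<Rightarrow> bool" where
  "violated n I x \<longleftrightarrow>
     (case sense_of I of Ge \<Rightarrow> lhs n I x < rhs I | Le \<Rightarrow> lhs n I x > rhs I)"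

definition correct_answer ::
    "nat \<Rightarrow> (nat \<Rightarrow> real) \<Rightarrow> ineq set \<Rightarrow> ineq option \<Rightarrow> bool" where
  "correct_answer n x F r \<longleftrightarrow>
     (case r of None \<Rightarrow> \<forall>I\<in>F. \<not> violated n I x | Some I \<Rightarrow> I \<in> F \<and> violated n I x)"


section \<open>The families\<close>

type_synonym family = "nat \<Rightarrow> (nat \<Rightarrow> real) \<Rightarrow> ineq set"

definition perm_ineq :: "(nat \<Rightarrow> real) \<Rightarrow> nat set \<Rightarrow> ineq" where
  "perm_ineq v J = Ineq (\<lambda>k. of_bool (k \<in> J)) Ge (\<Sum>j = 1..card J. v j)"

definition P :: family where
  "P n v = {perm_ineq v J | J. J \<noteq> {} \<and> J \<subseteq> {3..n}}"

definition T1 :: family where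
  "T1 n v = {Ineq (\<lambda>k. of_bool (k = i) + of_bool (k = j)) Ge (v 1 + v 2) | i j.
     i \<in> {3..n} \<and> j \<in> {3..n} \<and> i \<noteq> j}"

definition T2 :: family where
  "T2 n v = {Ineq (\<lambda>k. (v 3 - v 1) * of_bool (k = 1) + (v 3 - v 2) * of_bool (k = 2))
     Ge ((v 3)\<^sup>2 - v 1 * v 2)}"

definition T3 :: family where
  "T3 n v = {Ineq (\<lambda>k. (v 2 - v 1) * of_bool (k = 2) + (v 3 - v 1) * of_bool (k = i))
     Ge (v 2 * v 3 - (v 1)\<^sup>2) | i. i \<in> {3..n}}"

definition T4 :: family where
  "T4 n v = {Ineq (\<lambda>k. (v (n - 1) - v (n - 2)) * of_bool (k = n - 1)
                     + (v n - v (n - 2)) * of_bool (k = n))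
     Le (v n * v (n - 1) - (v (n - 2))\<^sup>2)}"

definition T5 :: family where
  "T5 n v = {Ineq (\<lambda>k. (v n - v (n - 2)) * of_bool (k = i)
                     + (v n - v (n - 1)) * of_bool (k = n - 1))
     Le ((v n)\<^sup>2 - v (n - 1) * v (n - 2)) | i. i \<in> {1..n - 2}}"

definition L0 :: family where
  "L0 n v = {Ineq (\<lambda>k. of_bool (k \<in> J)) Ge (1/2 * real m * (real m + 1)) | m J.
     m \<in> {2..n} \<and> J \<subseteq> {m+1..n} \<and> card J = m}"

datatype ltype = L1a | L1b | L2a | L2b | L2c | L2d | L2e

definition level1_ineqs :: "real \<Rightarrow> real \<Rightarrow> nat \<Rightarrow> nat \<Rightarrow> ineq set" where
  "level1_ineqs c \<alpha> n m =
     {Ineq (\<lambda>k. of_bool (k = m) + c * of_bool (k \<in> K)) Ge \<alpha> | K.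
        K \<subseteq> {m+1..n} \<and> card K = m - 1}"

definition level2_ineqs ::
    "real \<Rightarrow> real \<Rightarrow> real \<Rightarrow> real \<Rightarrow> nat \<Rightarrow> nat \<Rightarrow> ineq set" where
  "level2_ineqs a b c \<alpha> n m =
     {Ineq (\<lambda>k. a * of_bool (k = m - 1) + b * of_bool (k = m) + c * of_bool (k \<in> L)) Ge \<alpha> | L.
        L \<subseteq> {m+1..n} \<and> card L = m - 2}"

fun m_min :: "ltype \<Rightarrow> nat" where
  "m_min L1a = 3"
| "m_min L1b = 2"
| "m_min L2a = 4"
| "m_min L2b = 4"
| "m_min L2c = 3"
| "m_min L2d = 3"
| "m_min L2e = 3"

definition m_max :: "ltype \<Rightarrow> nat \<Rightarrow> int" where
  "m_max t n = (if t \<in> {L1a, L1b} then \<lceil>real n / 2\<rceil> else \<lceil>(real n + 1) / 2\<rceil>)"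

definition m_range :: "ltype \<Rightarrow> nat \<Rightarrow> nat set" where
  "m_range t n = {m. m_min t \<le> m \<and> int m \<le> m_max t n \<and> int n - int m \<ge> 4}"

fun level_ineqs :: "ltype \<Rightarrow> nat \<Rightarrow> nat \<Rightarrow> ineq set" where
  "level_ineqs L1a n m = level1_ineqs 1 (1/2 * real m * (real m + 1)) n m"
| "level_ineqs L1b n m = level1_ineqs 2 ((real m)\<^sup>2 + 1) n m"
| "level_ineqs L2a n m = level2_ineqs 1 1 1 (1/2 * real m * (real m + 1)) n m"
| "level_ineqs L2b n m = level2_ineqs 2 1 2 ((real m)\<^sup>2 + 1) n m"
| "level_ineqs L2c n m = level2_ineqs 2 1 4 (real m * (2 * real m - 3) + 5) n m"
| "level_ineqs L2d n m = level2_ineqs 3 2 4 (real m * (2 * real m - 1) + 4) n m"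
| "level_ineqs L2e n m = level2_ineqs 3 2 5 (5/2 * real m * (real m - 1) + 6) n m"

definition level_family :: "ltype \<Rightarrow> family" where
  "level_family t n v = (\<Union>m\<in>m_range t n. level_ineqs t n m)"

text \<open>The admissible vectors \<open>v\<close> for the different families.\<close>

definition general :: "nat \<Rightarrow> (nat \<Rightarrow> real) \<Rightarrow> bool" where
  "general n v \<longleftrightarrow> 1 \<le> n \<and> 0 \<le> v 1 \<and> strict_mono_on {1..n} v"

definition general6 :: "nat \<Rightarrow> (nat \<Rightarrow> real) \<Rightarrow> bool" where
  "general6 n v \<longleftrightarrow> general n v \<and> 6 \<le> n"

definition standard :: "nat \<Rightarrow> (nat \<Rightarrow> real) \<Rightarrow> bool" where
  "standard n v \<longleftrightarrow> 1 \<le> n \<and> (\<forall>i\<in>{1..n}. v i = real i)"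


section \<open>A real RAM\<close>

text \<open>The model of computation is the unit-cost real RAM, presented as a structured language.
  There are scalar variables and arrays holding natural numbers (sizes, indices, counters) and,
  in separate name spaces, scalar variables and arrays holding real numbers.  The operations on
  natural numbers are addition, truncated subtraction and halving; those on reals are the four
  field operations (with \<open>y / 0 = 0\<close>).  Reals can be compared but not rounded, and the only real
  constants available to a program are conversions of natural numbers, so that no information
  can be hidden in a real constant.  A program is a fixed finite object that works for
  all \<open>n\<close>.  Every node of an expression, every assignment and every test costs one step.\<close>

datatype iexp = INum nat | IVar string | IElem string iexp
  | IAdd iexp iexp | ISub iexp iexp | IHalf iexp

datatype rexp = RNat iexp | RVar string | RElem string iexp
  | RAdd rexp rexp | RSub rexp rexp | RMul rexp rexp | RDiv rexp rexp

datatype bexp = ILess iexp iexp | RLess rexp rexp | Neg bexp | Conj bexp bexp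

datatype com = SKIP
  | ISet string iexp | IStore string iexp iexp
  | RSet string rexp | RStore string iexp rexp
  | Seq com com | Cond bexp com com | While bexp com

record state =
  ivar :: "string \<Rightarrow> nat"
  iarr :: "string \<Rightarrow> nat \<Rightarrow> nat"
  rvar :: "string \<Rightarrow> real"
  rarr :: "string \<Rightarrow> nat \<Rightarrow> real"

fun ival :: "iexp \<Rightarrow> state \<Rightarrow> nat" where
  "ival (INum k) s = k"
| "ival (IVar y) s = ivar s y"
| "ival (IElem y e) s = iarr s y (ival e s)"
| "ival (IAdd d e) s = ival d s + ival e s"
| "ival (ISub d e) s = ival d s - ival e s"
| "ival (IHalf e) s = ival e s div 2"

fun rval :: "rexp \<Rightarrow> state \<Rightarrow> real" where
  "rval (RNat e) s = real (ival e s)"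
| "rval (RVar y) s = rvar s y"
| "rval (RElem y e) s = rarr s y (ival e s)"
| "rval (RAdd d e) s = rval d s + rval e s"
| "rval (RSub d e) s = rval d s - rval e s"
| "rval (RMul d e) s = rval d s * rval e s"
| "rval (RDiv d e) s = rval d s / rval e s"

fun bval :: "bexp \<Rightarrow> state \<Rightarrow> bool" where
  "bval (ILess d e) s \<longleftrightarrow> ival d s < ival e s"
| "bval (RLess d e) s \<longleftrightarrow> rval d s < rval e s"
| "bval (Neg b) s \<longleftrightarrow> \<not> bval b s"
| "bval (Conj a b) s \<longleftrightarrow> bval a s \<and> bval b s"

fun icost :: "iexp \<Rightarrow> nat" where
  "icost (INum k) = 1"
| "icost (IVar y) = 1"
| "icost (IElem y e) = 1 + icost e"
| "icost (IAdd d e) = 1 + icost d + icost e"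
| "icost (ISub d e) = 1 + icost d + icost e"
| "icost (IHalf e) = 1 + icost e"

fun rcost :: "rexp \<Rightarrow> nat" where
  "rcost (RNat e) = 1 + icost e"
| "rcost (RVar y) = 1"
| "rcost (RElem y e) = 1 + icost e"
| "rcost (RAdd d e) = 1 + rcost d + rcost e"
| "rcost (RSub d e) = 1 + rcost d + rcost e"
| "rcost (RMul d e) = 1 + rcost d + rcost e"
| "rcost (RDiv d e) = 1 + rcost d + rcost e"

fun bcost :: "bexp \<Rightarrow> nat" where
  "bcost (ILess d e) = 1 + icost d + icost e"
| "bcost (RLess d e) = 1 + rcost d + rcost e"
| "bcost (Neg b) = 1 + bcost b"
| "bcost (Conj a b) = 1 + bcost a + bcost b"

text \<open>\<open>exec c s k s'\<close>: started in \<open>s\<close>, the program \<open>c\<close> halts in \<open>s'\<close> after \<open>k\<close> steps.\<close>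

inductive exec :: "com \<Rightarrow> state \<Rightarrow> nat \<Rightarrow> state \<Rightarrow> bool" where
  Skip: "exec SKIP s 1 s"
| ISet: "exec (ISet y e) s (1 + icost e) (s\<lparr>ivar := (ivar s)(y := ival e s)\<rparr>)"
| IStore: "exec (IStore y d e) s (1 + icost d + icost e)
    (s\<lparr>iarr := (iarr s)(y := (iarr s y)(ival d s := ival e s))\<rparr>)"
| RSet: "exec (RSet y e) s (1 + rcost e) (s\<lparr>rvar := (rvar s)(y := rval e s)\<rparr>)"
| RStore: "exec (RStore y d e) s (1 + icost d + rcost e)
    (s\<lparr>rarr := (rarr s)(y := (rarr s y)(ival d s := rval e s))\<rparr>)"
| Seq: "exec c s k s' \<Longrightarrow> exec d s' l s'' \<Longrightarrow> exec (Seq c d) s (k + l) s''"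
| CondTrue: "bval b s \<Longrightarrow> exec c s k s' \<Longrightarrow> exec (Cond b c d) s (1 + bcost b + k) s'"
| CondFalse: "\<not> bval b s \<Longrightarrow> exec d s k s' \<Longrightarrow> exec (Cond b c d) s (1 + bcost b + k) s'"
| WhileFalse: "\<not> bval b s \<Longrightarrow> exec (While b c) s (1 + bcost b) s"
| WhileTrue: "bval b s \<Longrightarrow> exec c s k s' \<Longrightarrow> exec (While b c) s' l s'' \<Longrightarrow>
    exec (While b c) s (1 + bcost b + k + l) s''"

inductive_cases exec_elims:
  "exec SKIP s k t" "exec (ISet y e) s k t" "exec (IStore y d e) s k t"
  "exec (RSet y e) s k t" "exec (RStore y d e) s k t" "exec (Seq c d) s k t"
  "exec (Cond b c d) s k t"

inductive_cases exec_WhileE: "exec (While b c) s k t"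

text \<open>Execution is deterministic, so the existential quantifiers in the next definition
  describe the unique run.\<close>

lemma exec_deterministic:
  "exec c s k t \<Longrightarrow> exec c s k' t' \<Longrightarrow> k' = k \<and> t' = t"
proof (induction arbitrary: k' t' rule: exec.induct)
  case (Skip s)
  then show ?case by (rule exec_elims(1)) simp
next
  case (ISet y e s)
  then show ?case by (rule exec_elims(2)) simp
next
  case (IStore y d e s)
  then show ?case by (rule exec_elims(3)) simp
next
  case (RSet y e s)
  then show ?case by (rule exec_elims(4)) simp
next
  case (RStore y d e s)
  then show ?case by (rule exec_elims(5)) simp
next
  case (Seq c s k s' d l s'')
  from Seq.prems obtain k1 s1 l1 where
    "exec c s k1 s1" "exec d s1 l1 t'" "k' = k1 + l1"
    by (rule exec_elims(6))
  with Seq.IH(1)[of k1 s1] Seq.IH(2)[of l1 t'] show ?case by simp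
next
  case (CondTrue b s c k s' d)
  from CondTrue.prems obtain k1 where
    "exec c s k1 t'" "k' = 1 + bcost b + k1"
    by (rule exec_elims(7)) (simp_all add: CondTrue.hyps(1))
  with CondTrue.IH[of k1 t'] show ?case by simp
next
  case (CondFalse b s d k s' c)
  from CondFalse.prems obtain k1 where
    "exec d s k1 t'" "k' = 1 + bcost b + k1"
    by (rule exec_elims(7)) (simp_all add: CondFalse.hyps(1))
  with CondFalse.IH[of k1 t'] show ?case by simp
next
  case (WhileFalse b s c)
  from WhileFalse.prems show ?case
    by (rule exec_WhileE) (use WhileFalse.hyps in simp_all)
next
  case (WhileTrue b s c k s' l s'')
  from WhileTrue.prems obtain k1 s1 l1 where
    "exec c s k1 s1" "exec (While b c) s1 l1 t'" "k' = 1 + bcost b + k1 + l1"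
    by (rule exec_WhileE) (simp_all add: WhileTrue.hyps(1))
  with WhileTrue.IH(1)[of k1 s1] WhileTrue.IH(2)[of l1 t'] show ?case by simp
qed

definition runs_within :: "com \<Rightarrow> state \<Rightarrow> nat \<Rightarrow> (state \<Rightarrow> bool) \<Rightarrow> bool" where
  "runs_within c s B Q \<longleftrightarrow> (\<exists>k s'. exec c s k s' \<and> k \<le> B \<and> Q s')"

text \<open>Input: the vectors \<open>v\<close> and \<open>x\<close> in positions \<open>1..n\<close> of two real arrays; everything else
  is zero.\<close>

definition init :: "nat \<Rightarrow> (nat \<Rightarrow> real) \<Rightarrow> (nat \<Rightarrow> real) \<Rightarrow> state" where
  "init n v x = \<lparr>
     ivar = (\<lambda>_. 0)(''n'' := n),
     iarr = (\<lambda>_ _. 0),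
     rvar = (\<lambda>_. 0),
     rarr = (\<lambda>_ _. 0)(''v'' := (\<lambda>i. if i \<in> {1..n} then v i else 0),
                      ''x'' := (\<lambda>i. if i \<in> {1..n} then x i else 0))\<rparr>"

text \<open>The output slot named \<open>y\<close> holds an inequality: its sense (0: no inequality, 1: \<open>\<ge>\<close>,
  otherwise \<open>\<le>\<close>), its coefficients in positions \<open>1..n\<close> and its right-hand side.\<close>

definition result :: "nat \<Rightarrow> string \<Rightarrow> state \<Rightarrow> ineq option" where
  "result n y s =
     (if ivar s y = 0 then None
      else Some (Ineq (\<lambda>i. if i \<in> {1..n} then rarr s y i else 0)
                      (if ivar s y = 1 then Ge else Le) (rvar s y)))"

text \<open>\<open>separates adm F c T\<close>: the program \<open>c\<close> solves the separation problem for the family \<open>F\<close>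
  (over the admissible \<open>n\<close> and \<open>v\<close>) with worst-case running time \<open>T\<close>.\<close>

definition separates ::
    "(nat \<Rightarrow> (nat \<Rightarrow> real) \<Rightarrow> bool) \<Rightarrow> family \<Rightarrow> com \<Rightarrow> (nat \<Rightarrow> nat) \<Rightarrow> bool" where
  "separates adm F c T \<longleftrightarrow>
     (\<forall>n v x. adm n v \<longrightarrow>
        runs_within c (init n v x) (T n)
          (\<lambda>s. correct_answer n x (F n v) (result n ''out'' s)))"

definition time_O :: "(nat \<Rightarrow> nat) \<Rightarrow> (nat \<Rightarrow> real) \<Rightarrow> bool" where
  "time_O T g \<longleftrightarrow> (\<lambda>n. real (T n)) \<in> O(g)"

definition poly_separable :: "(nat \<Rightarrow> (nat \<Rightarrow> real) \<Rightarrow> bool) \<Rightarrow> family \<Rightarrow> bool" where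
  "poly_separable adm F \<longleftrightarrow>
     (\<exists>c T d. time_O T (\<lambda>n. real n ^ d) \<and> separates adm F c T)"


section \<open>Sorting\<close>

definition sorted_order :: "nat set \<Rightarrow> (nat \<Rightarrow> real) \<Rightarrow> nat list \<Rightarrow> bool" where
  "sorted_order A x js \<longleftrightarrow> distinct js \<and> set js = A \<and> sorted (map x js)"

text \<open>The result of testing \<open>m = 1, 2, \<dots>\<close> in turn and stopping at the first violation.\<close>

definition check_fails :: "(nat \<Rightarrow> real) \<Rightarrow> nat list \<Rightarrow> nat \<Rightarrow> bool" where
  "check_fails x js m \<longleftrightarrow>
     m \<in> {1..length js} \<and> (\<Sum>i<m. x (js ! i)) < 1/2 * real m * (real m + 1)"

definition successive_check :: "(nat \<Rightarrow> real) \<Rightarrow> nat list \<Rightarrow> ineq option" where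
  "successive_check x js =
     (if \<exists>m. check_fails x js m
      then Some (perm_ineq real (set (take (LEAST m. check_fails x js m) js)))
      else None)"

text \<open>The sorted order \<open>js\<close>, shifted to 1-based positions, is stored in the array \<open>''p''\<close>.\<close>

definition holds_order :: "nat list \<Rightarrow> state \<Rightarrow> bool" where
  "holds_order js s \<longleftrightarrow> (\<forall>i\<in>{1..length js}. iarr s ''p'' i = js ! (i - 1))"

definition sorts :: "com \<Rightarrow> (nat \<Rightarrow> nat) \<Rightarrow> bool" where
  "sorts c T \<longleftrightarrow>
     (\<forall>n v x. standard n v \<longrightarrow>
        runs_within c (init n v x) (T n) (\<lambda>s. \<exists>js. sorted_order {1..n} x js \<and> holds_order js s))"

definition init_sorted ::
    "nat \<Rightarrow> (nat \<Rightarrow> real) \<Rightarrow> (nat \<Rightarrow> real) \<Rightarrow> nat list \<Rightarrow> nat \<Rightarrow> state" where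
  "init_sorted n v x js m = (init n v x)
     \<lparr>ivar := (\<lambda>_. 0)(''n'' := n, ''m'' := m),
      iarr := (\<lambda>_ _. 0)(''p'' := (\<lambda>i. if i \<in> {1..n} then js ! (i - 1) else 0))\<rparr>"

definition separates_sorted :: "ltype \<Rightarrow> com \<Rightarrow> (nat \<Rightarrow> nat) \<Rightarrow> bool" where
  "separates_sorted t c T \<longleftrightarrow>
     (\<forall>n v x js m. standard n v \<and> sorted_order {1..n} x js \<and> m \<in> m_range t n \<longrightarrow>
        runs_within c (init_sorted n v x js m) (T n)
          (\<lambda>s. correct_answer n x (level_ineqs t n m) (result n ''out'' s)))"

text \<open>Output slots of an algorithm that treats all types of levels 1 and 2 in one run.\<close>

fun slot :: "ltype \<Rightarrow> string" where
  "slot L1a = ''L1a''"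
| "slot L1b = ''L1b''"
| "slot L2a = ''L2a''"
| "slot L2b = ''L2b''"
| "slot L2c = ''L2c''"
| "slot L2d = ''L2d''"
| "slot L2e = ''L2e''"

definition separates_levels :: "com \<Rightarrow> (nat \<Rightarrow> nat) \<Rightarrow> bool" where
  "separates_levels c T \<longleftrightarrow>
     (\<forall>n v x. standard n v \<longrightarrow>
        runs_within c (init n v x) (T n)
          (\<lambda>s. \<forall>t. correct_answer n x (level_family t n v) (result n (slot t) s)))"

end

theory Submission
  imports Defs "HOL-Library.Log_Nat"
begin

text \<open>
  Every family is a collection of inequalities that differ, for a fixed size, only in a set of
  indices carrying one common positive coefficient.  For a \<open>\<ge>\<close>-inequality the best chance of a
  violation is then the set of the required number of smallest entries of the point
  (\<open>sum_le_exchange\<close>), and after sorting this set can be read off.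

  For (P) the candidates are the prefixes of the sorted order, one for each size
  (\<open>prefix_minimal\<close>, \<open>first_failure_correct\<close>), so that \<open>n - 2\<close> prefix sums have to be compared
  with the right-hand sides.  For levels 0, 1 and 2 and a fixed \<open>m\<close>, the entries at \<open>m - 1\<close> and
  \<open>m\<close> contribute a constant, and the best set is found by one pass over the sorted order that
  picks the first entries with index above \<open>m\<close> (\<open>greedy_optimal\<close>, \<open>level_step_correct\<close>); the
  families of these levels differ in a handful of natural numbers, collected in a \<open>shape\<close>.  The
  two-term inequalities have one fixed index and are scanned along the other; for (T1) an index
  of a smallest entry can be taken as the fixed one (\<open>T1_by_smallest\<close>).

  The remaining work is to run this on the real RAM within the stated number of steps.
  Loop-free programs are evaluated symbolically with a syntactic bound on their cost, and all
  loops but one are counting loops, for which \<open>runs_within_for_to\<close> gives correctness and cost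
  from an invariant.  The exception is the doubling of the block width in a bottom-up merge sort,
  which takes logarithmically many rounds; a round is a single counting loop that outputs one
  entry per iteration (\<open>merge_step_correct\<close>), hence linear.
\<close>

section \<open>Running time of loops\<close>

fun seqs :: "com list \<Rightarrow> com" where
  "seqs [] = SKIP"
| "seqs (c # cs) = Seq c (seqs cs)"

fun straight :: "com \<Rightarrow> bool" where
  "straight (Seq c d) \<longleftrightarrow> straight c \<and> straight d"
| "straight (Cond b c d) \<longleftrightarrow> straight c \<and> straight d"
| "straight (While b c) \<longleftrightarrow> False"
| "straight _ \<longleftrightarrow> True"

text \<open>The effect of a loop-free program; the equation for \<open>While\<close> is a dummy value that
  \<open>straight\<close> excludes.\<close>

fun eff :: "com \<Rightarrow> state \<Rightarrow> state" where
  "eff SKIP s = s"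
| "eff (ISet y e) s = s\<lparr>ivar := (ivar s)(y := ival e s)\<rparr>"
| "eff (IStore y d e) s = s\<lparr>iarr := (iarr s)(y := (iarr s y)(ival d s := ival e s))\<rparr>"
| "eff (RSet y e) s = s\<lparr>rvar := (rvar s)(y := rval e s)\<rparr>"
| "eff (RStore y d e) s = s\<lparr>rarr := (rarr s)(y := (rarr s y)(ival d s := rval e s))\<rparr>"
| "eff (Seq c d) s = eff d (eff c s)"
| "eff (Cond b c d) s = (if bval b s then eff c s else eff d s)"
| "eff (While b c) s = s"

fun max_cost :: "com \<Rightarrow> nat" where
  "max_cost SKIP = 1"
| "max_cost (ISet y e) = 1 + icost e"
| "max_cost (IStore y d e) = 1 + icost d + icost e"
| "max_cost (RSet y e) = 1 + rcost e"
| "max_cost (RStore y d e) = 1 + icost d + rcost e"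
| "max_cost (Seq c d) = max_cost c + max_cost d"
| "max_cost (Cond b c d) = 1 + bcost b + max (max_cost c) (max_cost d)"
| "max_cost (While b c) = 0"

fun written :: "com \<Rightarrow> string set" where
  "written SKIP = {}"
| "written (ISet y e) = {y}"
| "written (IStore y d e) = {y}"
| "written (RSet y e) = {y}"
| "written (RStore y d e) = {y}"
| "written (Seq c d) = written c \<union> written d"
| "written (Cond b c d) = written c \<union> written d"
| "written (While b c) = written c"

text \<open>Frame conditions.  A name counts as written if it is assigned in any of the four name
  spaces, so invariants have to mention a component whose name is shared with an assigned one.\<close>

definition agree :: "string set \<Rightarrow> state \<Rightarrow> state \<Rightarrow> bool" where
  "agree W s t \<longleftrightarrow> (\<forall>y. y \<notin> W \<longrightarrow>
     ivar t y = ivar s y \<and> iarr t y = iarr s y \<and> rvar t y = rvar s y \<and> rarr t y = rarr s y)"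

lemma agree_refl [simp]: "agree W s s"
  by (simp add: agree_def)

lemma agree_trans: "agree W s t \<Longrightarrow> agree W t u \<Longrightarrow> agree W s u"
  by (simp add: agree_def)

lemma agree_set_ivar: "y \<in> W \<Longrightarrow> agree W s (s\<lparr>ivar := (ivar s)(y := a)\<rparr>)"
  by (auto simp: agree_def)

lemma exec_agree: "exec c s k t \<Longrightarrow> agree (written c) s t"
  by (induction rule: exec.induct) (auto simp: agree_def)

lemma runs_within_agree:
  "runs_within c s B Q \<Longrightarrow> runs_within c s B (\<lambda>t. Q t \<and> agree (written c) s t)"
  unfolding runs_within_def using exec_agree by blast

lemma runs_within_mono:
  "runs_within c s B Q \<Longrightarrow> B \<le> B' \<Longrightarrow> (\<And>t. Q t \<Longrightarrow> R t) \<Longrightarrow> runs_within c s B' R"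
  unfolding runs_within_def by (meson le_trans)

lemma runs_within_conj_agree:
  assumes "runs_within c s B Q" "B \<le> B'" "\<And>t. Q t \<Longrightarrow> agree (written c) s t \<Longrightarrow> R t"
  shows "runs_within c s B' R"
  using runs_within_mono[OF runs_within_agree[OF assms(1)] assms(2)] assms(3) by blast

lemma runs_within_Seq:
  assumes "runs_within c s B Q" "\<And>t. Q t \<Longrightarrow> agree (written c) s t \<Longrightarrow> runs_within d t B' R"
    "B + B' \<le> B''"
  shows "runs_within (Seq c d) s B'' R"
proof -
  obtain k t where "exec c s k t" "k \<le> B" "Q t"
    using assms(1) unfolding runs_within_def by blast
  moreover from this obtain l u where "exec d t l u" "l \<le> B'" "R u"
    using assms(2) exec_agree unfolding runs_within_def by blast
  ultimately show ?thesis
    unfolding runs_within_def using exec.Seq[of c s k t d l u] assms(3)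
    by (intro exI[of _ "k + l"] exI[of _ u]) auto
qed

lemma exec_eff: "straight c \<Longrightarrow> \<exists>k\<le>max_cost c. exec c s k (eff c s)"
proof (induction c arbitrary: s)
  case (Seq c d)
  then obtain k l where "k \<le> max_cost c" "exec c s k (eff c s)"
    "l \<le> max_cost d" "exec d (eff c s) l (eff d (eff c s))"
    by fastforce
  then show ?case
    by (auto intro!: exI[of _ "k + l"] exec.Seq)
next
  case (Cond b c d)
  then obtain k l where "k \<le> max_cost c" "exec c s k (eff c s)"
    "l \<le> max_cost d" "exec d s l (eff d s)"
    by fastforce
  then show ?case
    using exec.CondTrue[of b s c k "eff c s" d] exec.CondFalse[of b s d l "eff d s" c]
    by (intro exI[of _ "1 + bcost b + (if bval b s then k else l)"]) auto
qed (auto intro: exec.intros simp del: One_nat_def)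

lemma runs_within_straight:
  "straight c \<Longrightarrow> Q (eff c s) \<Longrightarrow> max_cost c \<le> B \<Longrightarrow> runs_within c s B Q"
  unfolding runs_within_def using exec_eff[of c s] le_trans by blast

lemma runs_within_straight_Seq:
  assumes "straight c" "runs_within d (eff c s) B Q" "max_cost c + B \<le> B'"
  shows "runs_within (Seq c d) s B' Q"
  using runs_within_straight[OF assms(1), of "\<lambda>t. t = eff c s"] assms(2)
  by (intro runs_within_Seq[where Q = "\<lambda>t. t = eff c s", OF _ _ assms(3)]) auto

lemma runs_within_Cond:
  assumes "bval b s \<Longrightarrow> runs_within c s B Q" "\<not> bval b s \<Longrightarrow> runs_within d s B Q"
    "1 + bcost b + B \<le> B'"
  shows "runs_within (Cond b c d) s B' Q"
proof (cases "bval b s")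
  case True
  with assms(1) obtain k t where "exec c s k t" "k \<le> B" "Q t"
    unfolding runs_within_def by blast
  with True assms(3) show ?thesis
    unfolding runs_within_def by (intro exI[of _ "1 + bcost b + k"] exI[of _ t]) (auto intro: exec.CondTrue simp del: One_nat_def)
next
  case False
  with assms(2) obtain k t where "exec d s k t" "k \<le> B" "Q t"
    unfolding runs_within_def by blast
  with False assms(3) show ?thesis
    unfolding runs_within_def by (intro exI[of _ "1 + bcost b + k"] exI[of _ t]) (auto intro: exec.CondFalse simp del: One_nat_def)
qed

text \<open>The invariant is indexed by a bound on the number of remaining iterations.\<close>

lemma runs_within_While:
  assumes "I N s"
    and "\<And>k t. I k t \<Longrightarrow> bval b t \<Longrightarrow> agree (written c) s t \<Longrightarrow>
           \<exists>j. k = Suc j \<and> runs_within c t K (I j)"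
  shows "runs_within (While b c) s ((1 + bcost b + K) * Suc N)
           (\<lambda>t. (\<exists>k. I k t) \<and> \<not> bval b t)"
proof -
  have "I k t \<Longrightarrow> agree (written c) s t \<Longrightarrow>
      runs_within (While b c) t ((1 + bcost b + K) * Suc k) (\<lambda>t. (\<exists>k. I k t) \<and> \<not> bval b t)" for k t
  proof (induction k arbitrary: t)
    case 0
    then have "\<not> bval b t" using assms(2) by blast
    with 0 show ?case
      unfolding runs_within_def
      by (intro exI[of _ "1 + bcost b"] exI[of _ t]) (auto intro: exec.WhileFalse simp del: One_nat_def)
  next
    case (Suc k)
    show ?case
    proof (cases "bval b t")
      case False
      with Suc.prems show ?thesis
        unfolding runs_within_def
        by (intro exI[of _ "1 + bcost b"] exI[of _ t]) (auto intro: exec.WhileFalse simp del: One_nat_def)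
    next
      case True
      then obtain l u where u: "exec c t l u" "l \<le> K" "I k u"
        using assms(2)[OF Suc.prems(1) _ Suc.prems(2)] unfolding runs_within_def by blast
      then have "agree (written c) s u"
        using Suc.prems(2) exec_agree agree_trans by blast
      with Suc.IH u(3) obtain l' u' where u': "exec (While b c) u l' u'"
        "l' \<le> (1 + bcost b + K) * Suc k" "(\<exists>k. I k u') \<and> \<not> bval b u'"
        unfolding runs_within_def by blast
      have "exec (While b c) t (1 + bcost b + l + l') u'"
        using True u(1) u'(1) by (rule exec.WhileTrue)
      moreover have "1 + bcost b + l + l' \<le> (1 + bcost b + K) * Suc (Suc k)"
        using u(2) u'(2) by simp
      ultimately show ?thesis
        unfolding runs_within_def using u'(3) by blast
    qed
  qed
  then show ?thesis using assms(1) by simp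
qed

text \<open>The counter is incremented before the body, which thus sees the values \<open>1\<close> to the bound,
  matching the arrays that start at position 1.\<close>

definition for_to :: "string \<Rightarrow> string \<Rightarrow> com \<Rightarrow> com" where
  "for_to i y c = Seq (ISet i (INum 0))
     (While (ILess (IVar i) (IVar y)) (Seq (ISet i (IAdd (IVar i) (INum 1))) c))"

lemma written_for_to [simp]: "written (for_to i y c) = insert i (written c)"
  by (simp add: for_to_def)

text \<open>\<open>I k\<close> describes the state after \<open>k\<close> iterations.  Each step may also use that everything
  outside the written names is still as in the initial state \<open>s\<close>, which keeps invariants short.\<close>

lemma runs_within_for_to:
  assumes names: "i \<notin> written c" "y \<notin> written c" "y \<noteq> i"
    and N: "N = ivar s y"
    and base: "I 0 (s\<lparr>ivar := (ivar s)(i := 0)\<rparr>)"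
    and step: "\<And>k t. k < N \<Longrightarrow> I k t \<Longrightarrow> ivar t i = k \<Longrightarrow> agree (insert i (written c)) s t \<Longrightarrow>
      runs_within c (t\<lparr>ivar := (ivar t)(i := Suc k)\<rparr>) K (I (Suc k))"
  shows "runs_within (for_to i y c) s ((10 + K) * Suc N) (I N)"
proof -
  let ?W = "insert i (written c)"
  let ?b = "ILess (IVar i) (IVar y)" and ?inc = "ISet i (IAdd (IVar i) (INum 1))"
  let ?s = "s\<lparr>ivar := (ivar s)(i := 0)\<rparr>"
  define J where "J = (\<lambda>j t. j \<le> N \<and> I (N - j) t \<and> ivar t i = N - j \<and> agree ?W s t)"
  have loop: "runs_within (While ?b (Seq ?inc c)) ?s ((1 + bcost ?b + (4 + K)) * Suc N)
      (\<lambda>t. (\<exists>k. J k t) \<and> \<not> bval ?b t)"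
  proof (rule runs_within_While)
    show "J N ?s"
      using base by (simp add: J_def agree_set_ivar)
  next
    fix j t assume J: "J j t" and b: "bval ?b t"
    have y: "ivar t y = N" using J names N by (auto simp: J_def agree_def)
    have j: "0 < j" using J b y by (simp add: J_def)
    have eq: "Suc (N - j) = N - (j - 1)" using J j unfolding J_def by linarith
    have i: "ivar t i = N - j" and ag: "agree ?W s t" using J by (simp_all add: J_def)
    let ?t = "t\<lparr>ivar := (ivar t)(i := Suc (N - j))\<rparr>"
    have "runs_within c ?t K (I (Suc (N - j)))"
      using J j by (intro step) (auto simp: J_def)
    then have "runs_within c ?t K (J (j - 1))"
    proof (rule runs_within_conj_agree[OF _ order_refl])
      fix u assume u: "I (Suc (N - j)) u" "agree (written c) ?t u"
      have "agree ?W t u"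
        using u(2) by (auto simp: agree_def)
      moreover have "ivar u i = Suc (N - j)"
        using u(2) names(1) by (simp add: agree_def)
      ultimately show "J (j - 1) u"
        using u(1) J j agree_trans[OF ag] unfolding J_def eq by auto
    qed
    then have "runs_within (Seq ?inc c) t (4 + K) (J (j - 1))"
      by (intro runs_within_straight_Seq[where B = K]) (simp_all add: i)
    then show "\<exists>j'. j = Suc j' \<and> runs_within (Seq ?inc c) t (4 + K) (J j')"
      using j by (intro exI[of _ "j - 1"]) simp
  qed
  show ?thesis
    unfolding for_to_def
  proof (rule runs_within_straight_Seq)
    have "runs_within (While ?b (Seq ?inc c)) ?s ((1 + bcost ?b + (4 + K)) * Suc N) (I N)"
    proof (rule runs_within_mono[OF loop order_refl])
      fix u assume "(\<exists>k. J k u) \<and> \<not> bval ?b u"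
      then obtain k where k: "J k u" "\<not> ivar u i < ivar u y" by auto
      have "ivar u y = N"
        using k(1) names N by (auto simp: J_def agree_def)
      with k have "k = 0" by (cases "N = 0") (auto simp: J_def)
      with k(1) show "I N u" by (simp add: J_def)
    qed
    then show "runs_within (While ?b (Seq ?inc c)) (eff (ISet i (INum 0)) s) ((8 + K) * Suc N) (I N)"
      by (simp add: numeral_eq_Suc)
  qed auto
qed

section \<open>Merge sort\<close>

text \<open>Block \<open>t\<close> occupies the positions \<open>t * w + 1\<close> to \<open>t * w + w\<close>, cut off at \<open>len\<close>.\<close>

definition blocks_sorted :: "(nat \<Rightarrow> real) \<Rightarrow> (nat \<Rightarrow> nat) \<Rightarrow> nat \<Rightarrow> nat \<Rightarrow> bool" where
  "blocks_sorted x p len w \<longleftrightarrow>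
     (\<forall>t a b. t * w < a \<and> a \<le> b \<and> b \<le> t * w + w \<and> b \<le> len \<longrightarrow> x (p a) \<le> x (p b))"

text \<open>The state in the middle of a round that merges neighbouring blocks of \<open>p\<close> into blocks of
  double width in \<open>q\<close>: \<open>k\<close> entries have been output, the current pair of blocks has number \<open>t\<close>,
  its two parts end at \<open>i'\<close> and \<open>j'\<close>, and they have been consumed up to \<open>i\<close> and \<open>j\<close>.  The image
  equation expresses that \<open>q\<close> rearranges \<open>p\<close>; in the end the image has as many
  elements as there are positions, which rules out repetitions.\<close>

definition merging :: "(nat \<Rightarrow> real) \<Rightarrow> (nat \<Rightarrow> nat) \<Rightarrow> nat \<Rightarrow> nat \<Rightarrow> (nat \<Rightarrow> nat) \<Rightarrow>
    nat \<Rightarrow> nat \<Rightarrow> nat \<Rightarrow> nat \<Rightarrow> nat \<Rightarrow> bool" where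
  "merging x p len w q k i i' j j' \<longleftrightarrow>
     (\<exists>t. t * (2 * w) \<le> i \<and> i \<le> i' \<and> i' \<le> j \<and> j \<le> j' \<and>
        i' = min (t * (2 * w) + w) len \<and> j' = min (t * (2 * w) + 2 * w) len \<and>
        k = i + (j - i') \<and> q ` {1..k} = p ` ({1..i} \<union> {i'<..j}) \<and>
        blocks_sorted x q k (2 * w) \<and>
        (\<forall>a b. t * (2 * w) < a \<and> a \<le> k \<and> (i < b \<and> b \<le> i' \<or> j < b \<and> b \<le> j')
           \<longrightarrow> x (q a) \<le> x (p b)))"

lemma block_unique:
  fixes t u w b :: nat
  assumes "t * w < b" "b \<le> t * w + w" "u * w < b" "b \<le> u * w + w"
  shows "t = u"
proof -
  have "\<not> t < u" if "t * w < b" "b \<le> t * w + w" "u * w < b" for t u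
  proof
    assume "t < u"
    then have "Suc t * w \<le> u * w" by (intro mult_right_mono) auto
    with that show False by simp
  qed
  then show ?thesis using assms by (meson linorder_neqE_nat)
qed

lemma merging_init:
  "merging x p len w q 0 0 (min w len) (min w len) (min (min w len + w) len)"
  unfolding merging_def by (intro exI[of _ 0]) (auto simp: blocks_sorted_def)

text \<open>As \<open>k < len\<close>, the exhausted pair of blocks was not cut off, so \<open>k\<close> is a multiple of
  \<open>2 * w\<close> and a new pair can start there.\<close>

lemma merging_next_block:
  assumes "merging x p len w q k i i' j j'" "\<not> i < i'" "\<not> j < j'" "k < len"
  shows "merging x p len w q k k (min (k + w) len) (min (k + w) len)
           (min (min (k + w) len + w) len)"
proof -
  obtain t where t: "t * (2 * w) \<le> i" "i \<le> i'" "i' \<le> j" "j \<le> j'"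
      "i' = min (t * (2 * w) + w) len" "j' = min (t * (2 * w) + 2 * w) len"
      "k = i + (j - i')" "q ` {1..k} = p ` ({1..i} \<union> {i'<..j})" "blocks_sorted x q k (2 * w)"
    using assms(1) unfolding merging_def by blast
  have k: "k = Suc t * (2 * w)" "i = i'" "j = k"
    using t(1-7) assms(2-4) by (auto simp: min_def split: if_splits)
  have "{1..i} \<union> {i'<..j} = {1..k}"
    using k t(3) by auto
  with t(8) have "q ` {1..k} = p ` {1..k}" by simp
  with t(9) assms(4) show ?thesis
    unfolding merging_def
    by (intro exI[of _ "Suc t"], unfold k(1)[symmetric]) (auto simp: min_def)
qed

text \<open>An entry appended to the current block only has to dominate the entries of that block.\<close>

lemma blocks_sorted_append:
  assumes "blocks_sorted x q k W" "t * W \<le> k" "Suc k \<le> t * W + W"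
    and "\<And>a. t * W < a \<Longrightarrow> a \<le> k \<Longrightarrow> x (q a) \<le> x y"
  shows "blocks_sorted x (q(Suc k := y)) (Suc k) W"
  unfolding blocks_sorted_def
proof (intro allI impI)
  fix u a b assume u: "u * W < a \<and> a \<le> b \<and> b \<le> u * W + W \<and> b \<le> Suc k"
  show "x ((q(Suc k := y)) a) \<le> x ((q(Suc k := y)) b)"
  proof (cases "b = Suc k")
    case True
    with u assms(2,3) have "u = t"
      by (intro block_unique[of u W b]) auto
    with True u assms(4) show ?thesis by (cases "a = Suc k") auto
  next
    case False
    with u assms(1) show ?thesis by (auto simp: blocks_sorted_def)
  qed
qed

text \<open>The consumed entry is smallest in the rest of its own block, and, by the comparison, at
  most the first and hence every remaining entry of the other block.\<close>

lemma merging_take_left: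
  assumes "merging x p len w q k i i' j j'" and p: "blocks_sorted x p len w"
    and i: "i < i'" and le: "j < j' \<Longrightarrow> x (p (Suc i)) \<le> x (p (Suc j))"
  shows "merging x p len w (q(Suc k := p (Suc i))) (Suc k) (Suc i) i' j j'"
proof -
  obtain t where t: "t * (2 * w) \<le> i" "i \<le> i'" "i' \<le> j" "j \<le> j'"
      "i' = min (t * (2 * w) + w) len" "j' = min (t * (2 * w) + 2 * w) len"
      "k = i + (j - i')" "q ` {1..k} = p ` ({1..i} \<union> {i'<..j})" "blocks_sorted x q k (2 * w)"
      "\<And>a b. t * (2 * w) < a \<and> a \<le> k \<and> (i < b \<and> b \<le> i' \<or> j < b \<and> b \<le> j')
           \<Longrightarrow> x (q a) \<le> x (p b)"
    using assms(1) unfolding merging_def by blast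
  let ?q = "q(Suc k := p (Suc i))"
  have left: "x (p (Suc i)) \<le> x (p b)" if "i < b" "b \<le> i'" for b
    using p[unfolded blocks_sorted_def, rule_format, of "2 * t" "Suc i" b] that t(1,5)
    by (auto simp: mult.assoc mult.left_commute)
  have right: "x (p (Suc i)) \<le> x (p b)" if b: "j < b" "b \<le> j'" for b
  proof -
    have "(2 * t + 1) * w = t * (2 * w) + w" by (simp add: algebra_simps)
    with b t have "x (p (Suc j)) \<le> x (p b)"
      by (intro p[unfolded blocks_sorted_def, rule_format, of "2 * t + 1"]) auto
    with le b show ?thesis by auto
  qed
  have "?q ` {1..Suc k} = insert (p (Suc i)) (q ` {1..k})"
    by (auto simp: image_iff le_Suc_eq)
  also have "\<dots> = p ` ({1..Suc i} \<union> {i'<..j})"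
    unfolding t(8) by (auto simp: atLeastAtMostSuc_conv)
  finally have im: "?q ` {1..Suc k} = p ` ({1..Suc i} \<union> {i'<..j})" .
  have "blocks_sorted x ?q (Suc k) (2 * w)"
  proof (rule blocks_sorted_append[where t = t])
    show "t * (2 * w) \<le> k" "Suc k \<le> t * (2 * w) + 2 * w" using t i by auto
    show "x (q a) \<le> x (p (Suc i))" if "t * (2 * w) < a" "a \<le> k" for a
      using that t(10)[of a "Suc i"] i by auto
  qed (fact t(9))
  moreover have "x (?q a) \<le> x (p b)"
    if "t * (2 * w) < a \<and> a \<le> Suc k \<and> (Suc i < b \<and> b \<le> i' \<or> j < b \<and> b \<le> j')" for a b
    using that left right t(10)[of a b] by auto
  ultimately show ?thesis
    unfolding merging_def using t(1-7) i im by (intro exI[of _ t]) auto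
qed

lemma merging_take_right:
  assumes "merging x p len w q k i i' j j'" and p: "blocks_sorted x p len w"
    and j: "j < j'" and le: "i < i' \<Longrightarrow> x (p (Suc j)) \<le> x (p (Suc i))"
  shows "merging x p len w (q(Suc k := p (Suc j))) (Suc k) i i' (Suc j) j'"
proof -
  obtain t where t: "t * (2 * w) \<le> i" "i \<le> i'" "i' \<le> j" "j \<le> j'"
      "i' = min (t * (2 * w) + w) len" "j' = min (t * (2 * w) + 2 * w) len"
      "k = i + (j - i')" "q ` {1..k} = p ` ({1..i} \<union> {i'<..j})" "blocks_sorted x q k (2 * w)"
      "\<And>a b. t * (2 * w) < a \<and> a \<le> k \<and> (i < b \<and> b \<le> i' \<or> j < b \<and> b \<le> j')
           \<Longrightarrow> x (q a) \<le> x (p b)"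
    using assms(1) unfolding merging_def by blast
  let ?q = "q(Suc k := p (Suc j))"
  have "(2 * t + 1) * w = t * (2 * w) + w" by (simp add: algebra_simps)
  then have right: "x (p (Suc j)) \<le> x (p b)" if "j < b" "b \<le> j'" for b
    using that t by (intro p[unfolded blocks_sorted_def, rule_format, of "2 * t + 1"]) auto
  have left: "x (p (Suc j)) \<le> x (p b)" if b: "i < b" "b \<le> i'" for b
  proof -
    have "x (p (Suc i)) \<le> x (p b)"
      using p[unfolded blocks_sorted_def, rule_format, of "2 * t" "Suc i" b] b t(1,5)
      by (auto simp: mult.assoc mult.left_commute)
    with le b show ?thesis by auto
  qed
  have "?q ` {1..Suc k} = insert (p (Suc j)) (q ` {1..k})"
    by (auto simp: image_iff le_Suc_eq)
  also have "\<dots> = p ` ({1..i} \<union> {i'<..Suc j})"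
    unfolding t(8) using t(3) by (auto simp: image_iff le_Suc_eq)
  finally have im: "?q ` {1..Suc k} = p ` ({1..i} \<union> {i'<..Suc j})" .
  have "blocks_sorted x ?q (Suc k) (2 * w)"
  proof (rule blocks_sorted_append[where t = t])
    show "t * (2 * w) \<le> k" "Suc k \<le> t * (2 * w) + 2 * w" using t j by auto
    show "x (q a) \<le> x (p (Suc j))" if "t * (2 * w) < a" "a \<le> k" for a
      using that t(10)[of a "Suc j"] j by auto
  qed (fact t(9))
  moreover have "x (?q a) \<le> x (p b)"
    if "t * (2 * w) < a \<and> a \<le> Suc k \<and> (i < b \<and> b \<le> i' \<or> Suc j < b \<and> b \<le> j')" for a b
    using that left right t(10)[of a b] by auto
  ultimately show ?thesis
    unfolding merging_def using t(1-7) j im by (intro exI[of _ t]) auto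
qed

lemma merging_done:
  assumes "merging x p len w q len i i' j j'"
  shows "blocks_sorted x q len (2 * w)" "q ` {1..len} = p ` {1..len}"
proof -
  obtain t where t: "t * (2 * w) \<le> i" "i \<le> i'" "i' \<le> j" "j \<le> j'"
      "j' = min (t * (2 * w) + 2 * w) len" "len = i + (j - i')"
      "q ` {1..len} = p ` ({1..i} \<union> {i'<..j})" "blocks_sorted x q len (2 * w)"
    using assms unfolding merging_def by blast
  then have "i = i'" "j = len" by auto
  with t(3) have "{1..i} \<union> {i'<..j} = {1..len}" by auto
  with t(7,8) show "blocks_sorted x q len (2 * w)" "q ` {1..len} = p ` {1..len}" by auto
qed

text \<open>With truncated subtraction, \<open>a - (a - b)\<close> is the minimum of \<open>a\<close> and \<open>b\<close>.\<close>

abbreviation imin :: "iexp \<Rightarrow> iexp \<Rightarrow> iexp" where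
  "imin d e \<equiv> ISub d (ISub d e)"

abbreviation If_then :: "bexp \<Rightarrow> com \<Rightarrow> com" where
  "If_then b c \<equiv> Cond b c SKIP"

definition start_block :: com where
  "start_block = seqs [
     ISet ''i1'' (imin (IAdd (IVar ''i'') (IVar ''w'')) (IVar ''len'')),
     ISet ''j'' (IVar ''i1''),
     ISet ''j1'' (imin (IAdd (IVar ''i1'') (IVar ''w'')) (IVar ''len''))]"

definition next_block :: com where
  "next_block =
     If_then (Conj (Neg (ILess (IVar ''i'') (IVar ''i1''))) (Neg (ILess (IVar ''j'') (IVar ''j1''))))
       (Seq (ISet ''i'' (ISub (IVar ''k'') (INum 1))) start_block)"

definition take_smaller :: com where
  "take_smaller =
     Cond (Conj (ILess (IVar ''i'') (IVar ''i1''))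
                (Neg (Conj (ILess (IVar ''j'') (IVar ''j1''))
                   (RLess (RElem ''x'' (IElem ''p'' (IAdd (IVar ''j'') (INum 1))))
                          (RElem ''x'' (IElem ''p'' (IAdd (IVar ''i'') (INum 1))))))))
       (seqs [ISet ''i'' (IAdd (IVar ''i'') (INum 1)),
              IStore ''q'' (IVar ''k'') (IElem ''p'' (IVar ''i''))])
       (seqs [ISet ''j'' (IAdd (IVar ''j'') (INum 1)),
              IStore ''q'' (IVar ''k'') (IElem ''p'' (IVar ''j''))])"

text \<open>Moving on to the next pair of blocks is part of the step that outputs an entry.  A round is
  thereby one loop with \<open>len\<close> iterations of constant cost, with no inner loop to be accounted
  for.\<close>

definition merge_step :: com where
  "merge_step = Seq next_block take_smaller"

lemmas merge_step_defs = merge_step_def next_block_def take_smaller_def start_block_def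

definition merge_pass :: com where
  "merge_pass = seqs [
     ISet ''i'' (INum 0), start_block,
     for_to ''k'' ''len'' merge_step,
     for_to ''i'' ''len'' (IStore ''p'' (IVar ''i'') (IElem ''q'' (IVar ''i''))),
     ISet ''w'' (IAdd (IVar ''w'') (IVar ''w''))]"

text \<open>The parameter \<open>a\<close> is the number of leading indices left out of the sort: 0 for the levels,
  2 for (P).\<close>

definition merge_sort :: "nat \<Rightarrow> com" where
  "merge_sort a = seqs [
     ISet ''len'' (ISub (IVar ''n'') (INum a)),
     for_to ''i'' ''len'' (IStore ''p'' (IVar ''i'') (IAdd (IVar ''i'') (INum a))),
     ISet ''w'' (INum 1),
     While (ILess (IVar ''w'') (IVar ''len'')) merge_pass]"

lemma diff_diff_eq_min: "(a::nat) - (a - b) = min a b"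
  by simp

lemma written_merge_pass:
  "written merge_pass = {''i'', ''i1'', ''j'', ''j1'', ''k'', ''q'', ''p'', ''w''}"
  by (auto simp: merge_pass_def merge_step_defs)

abbreviation merging_state :: "(nat \<Rightarrow> real) \<Rightarrow> (nat \<Rightarrow> nat) \<Rightarrow> nat \<Rightarrow> nat \<Rightarrow> nat \<Rightarrow> state \<Rightarrow> bool" where
  "merging_state x p len w k t \<equiv> merging x p len w (iarr t ''q'') k
     (ivar t ''i'') (ivar t ''i1'') (ivar t ''j'') (ivar t ''j1'')"

lemma merge_step_correct:
  assumes "merging_state x p len w k t" "blocks_sorted x p len w" "k < len" "1 \<le> w"
    "ivar t ''k'' = Suc k" "rarr t ''x'' = x" "iarr t ''p'' = p"
    "ivar t ''len'' = len" "ivar t ''w'' = w"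
  shows "merging_state x p len w (Suc k) (eff merge_step t)"
proof -
  define u where "u = eff next_block t"
  have u: "merging_state x p len w k u" "ivar u ''k'' = Suc k"
      "rarr u ''x'' = x" "iarr u ''p'' = p"
      "ivar u ''i'' < ivar u ''i1'' \<or> ivar u ''j'' < ivar u ''j1''"
    using assms merging_next_block[OF assms(1) _ _ assms(3)]
    by (auto simp: u_def next_block_def start_block_def diff_diff_eq_min)
  have "eff merge_step t = eff take_smaller u"
    by (simp add: merge_step_def u_def)
  then show ?thesis
    using merging_take_left[OF u(1) assms(2)] merging_take_right[OF u(1) assms(2)] u(2-5)
    by (auto simp: take_smaller_def)
qed

text \<open>Here and below the numerical constants in the bounds are rounded up generously.\<close>

lemma merge_pass_correct:
  assumes x: "rarr s ''x'' = x" and p: "iarr s ''p'' = p" and w: "ivar s ''w'' = w" "1 \<le> w"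
    and len: "ivar s ''len'' = len" and sorted: "blocks_sorted x p len w"
  shows "runs_within merge_pass s (300 * Suc len)
    (\<lambda>t. ivar t ''w'' = 2 * w \<and> blocks_sorted x (iarr t ''p'') len (2 * w) \<and>
         iarr t ''p'' ` {1..len} = p ` {1..len})"
proof -
  let ?s = "eff start_block (eff (ISet ''i'' (INum 0)) s)"
  let ?copy = "IStore ''p'' (IVar ''i'') (IElem ''q'' (IVar ''i''))"
  have merge: "runs_within (for_to ''k'' ''len'' merge_step) ?s
      ((10 + 100) * Suc len) (merging_state x p len w len)"
  proof (rule runs_within_for_to[where I = "\<lambda>k. merging_state x p len w k"])
    show "len = ivar ?s ''len''"
      by (simp add: start_block_def len)
    show "merging_state x p len w 0 (?s\<lparr>ivar := (ivar ?s)(''k'' := 0)\<rparr>)"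
      using merging_init[of x p len w] by (simp add: start_block_def len w diff_diff_eq_min)
  next
    fix k t assume t: "k < len" "merging_state x p len w k t" "ivar t ''k'' = k"
      "agree (insert ''k'' (written merge_step)) ?s t"
    let ?t = "t\<lparr>ivar := (ivar t)(''k'' := Suc k)\<rparr>"
    have "rarr t ''x'' = x" "iarr t ''p'' = p" "ivar t ''len'' = len" "ivar t ''w'' = w"
      using t(4) x p len w by (auto simp: agree_def merge_step_defs)
    then have "merging_state x p len w (Suc k) (eff merge_step ?t)"
      using t(1,2) w(2) sorted by (intro merge_step_correct) auto
    then show "runs_within merge_step ?t 100 (merging_state x p len w (Suc k))"
      by (intro runs_within_straight) (auto simp: merge_step_defs)
  qed (auto simp: merge_step_defs)
  have copy: "runs_within (seqs [for_to ''i'' ''len'' ?copy, ISet ''w'' (IAdd (IVar ''w'') (IVar ''w''))])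
      t ((20 + 10) * Suc len)
      (\<lambda>t. ivar t ''w'' = 2 * w \<and> blocks_sorted x (iarr t ''p'') len (2 * w) \<and>
         iarr t ''p'' ` {1..len} = p ` {1..len})"
    if t: "merging_state x p len w len t" "agree (written (for_to ''k'' ''len'' merge_step)) ?s t" for t
  proof -
    have eqs: "ivar t ''len'' = len" "ivar t ''w'' = w"
      using t(2) len w by (auto simp: agree_def merge_step_defs)
    have *: "runs_within (for_to ''i'' ''len'' ?copy) t ((10 + 10) * Suc len)
        (\<lambda>u. \<forall>a\<in>{1..len}. iarr u ''p'' a = iarr t ''q'' a)"
    proof (rule runs_within_for_to[where I = "\<lambda>k u. \<forall>a\<in>{1..k}. iarr u ''p'' a = iarr t ''q'' a"])
      fix k u assume u: "\<forall>a\<in>{1..k}. iarr u ''p'' a = iarr t ''q'' a"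
        "agree (insert ''i'' (written ?copy)) t u"
      then have "iarr u ''q'' = iarr t ''q''" by (simp add: agree_def)
      with u(1) show "runs_within ?copy (u\<lparr>ivar := (ivar u)(''i'' := Suc k)\<rparr>) 10
          (\<lambda>u. \<forall>a\<in>{1..Suc k}. iarr u ''p'' a = iarr t ''q'' a)"
        by (intro runs_within_straight) (auto simp: le_Suc_eq)
    qed (simp_all add: eqs)
    show ?thesis
      unfolding seqs.simps
    proof (rule runs_within_Seq[OF *, where B' = 5])
      fix u assume u: "\<forall>a\<in>{1..len}. iarr u ''p'' a = iarr t ''q'' a"
        "agree (written (for_to ''i'' ''len'' ?copy)) t u"
      have "blocks_sorted x (iarr u ''p'') len (2 * w)"
        using merging_done(1)[OF t(1)] u(1) by (auto simp: blocks_sorted_def)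
      moreover have "iarr u ''p'' ` {1..len} = p ` {1..len}"
        using merging_done(2)[OF t(1)] u(1) by (metis image_cong)
      moreover have "ivar u ''w'' = w"
        using u(2) eqs by (simp add: agree_def)
      ultimately show "runs_within (Seq (ISet ''w'' (IAdd (IVar ''w'') (IVar ''w''))) SKIP) u 5
        (\<lambda>t. ivar t ''w'' = 2 * w \<and> blocks_sorted x (iarr t ''p'') len (2 * w) \<and>
         iarr t ''p'' ` {1..len} = p ` {1..len})"
        by (intro runs_within_straight) auto
    qed simp
  qed
  show ?thesis
    unfolding merge_pass_def seqs.simps
    apply (rule runs_within_straight_Seq[where B = "250 * Suc len"])
      apply simp
     apply (rule runs_within_straight_Seq[where B = "150 * Suc len"])
       apply (simp add: start_block_def)
      apply (rule runs_within_Seq[OF merge, where B' = "(20 + 10) * Suc len"])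
       apply (rule copy[unfolded seqs.simps], assumption, assumption)
      apply (auto simp: start_block_def)
    done
qed

lemma blocks_sorted_singletons: "blocks_sorted x p len 1"
  unfolding blocks_sorted_def
proof (intro allI impI)
  fix t a b :: nat assume "t * 1 < a \<and> a \<le> b \<and> b \<le> t * 1 + 1 \<and> b \<le> len"
  then have "a = b" by linarith
  then show "x (p a) \<le> x (p b)" by simp
qed

text \<open>With \<open>d\<close> rounds to go the width is at least \<open>len / 2 ^ d\<close>; once it reaches \<open>len\<close> everything
  is a single sorted block.\<close>

lemma merge_sort_correct:
  fixes a :: nat
  assumes n: "ivar s ''n'' = n" and L: "n \<le> 2 ^ L"
  shows "runs_within (merge_sort a) s (400 * (Suc n * Suc L))
    (\<lambda>t. \<exists>js. sorted_order {Suc a..n} (rarr s ''x'') js \<and> holds_order js t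
        \<and> ivar t ''len'' = n - a \<and> length js = n - a)"
proof -
  define len where "len = n - a"
  define x where "x = rarr s ''x''"
  define I where "I = (\<lambda>d (t :: state). 1 \<le> ivar t ''w'' \<and> len \<le> ivar t ''w'' * 2 ^ d \<and>
    blocks_sorted x (iarr t ''p'') len (ivar t ''w'') \<and> iarr t ''p'' ` {1..len} = {Suc a..n})"
  let ?id = "IStore ''p'' (IVar ''i'') (IAdd (IVar ''i'') (INum a))"
  let ?s = "eff (ISet ''len'' (ISub (IVar ''n'') (INum a))) s"
  have id: "runs_within (for_to ''i'' ''len'' ?id) ?s ((10 + 10) * Suc len)
      (\<lambda>t. \<forall>i\<in>{1..len}. iarr t ''p'' i = i + a)"
    by (rule runs_within_for_to[where I = "\<lambda>k t. \<forall>i\<in>{1..k}. iarr t ''p'' i = i + a"])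
      (auto intro!: runs_within_straight simp: n len_def le_Suc_eq)
  have loop: "runs_within (While (ILess (IVar ''w'') (IVar ''len'')) merge_pass) t
      ((4 + 300 * Suc len) * Suc L) (\<lambda>u. (\<exists>d. I d u) \<and> \<not> ivar u ''w'' < ivar u ''len'')"
    if t: "I L t" "rarr t ''x'' = x" "ivar t ''len'' = len" for t
  proof -
    have "\<exists>d'. d = Suc d' \<and> runs_within merge_pass u (300 * Suc len) (I d')"
      if u: "I d u" "ivar u ''w'' < ivar u ''len''" "agree (written merge_pass) t u" for d u
    proof (cases d)
      case 0
      with u t show ?thesis
        by (auto simp: I_def written_merge_pass agree_def)
    next
      case (Suc d')
      let ?w = "ivar u ''w''"
      have "rarr u ''x'' = x" "ivar u ''len'' = len"
        using u(3) t by (auto simp: written_merge_pass agree_def)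
      with u(1) have "runs_within merge_pass u (300 * Suc len)
        (\<lambda>t. ivar t ''w'' = 2 * ?w \<and> blocks_sorted x (iarr t ''p'') len (2 * ?w) \<and>
          iarr t ''p'' ` {1..len} = iarr u ''p'' ` {1..len})"
        by (intro merge_pass_correct) (auto simp: I_def)
      then have "runs_within merge_pass u (300 * Suc len) (I d')"
        using u(1) Suc by (elim runs_within_mono) (auto simp: I_def mult_ac)
      with Suc show ?thesis by blast
    qed
    then have "runs_within (While (ILess (IVar ''w'') (IVar ''len'')) merge_pass) t
      ((1 + bcost (ILess (IVar ''w'') (IVar ''len'')) + 300 * Suc len) * Suc L)
      (\<lambda>u. (\<exists>d. I d u) \<and> \<not> bval (ILess (IVar ''w'') (IVar ''len'')) u)"
      by (intro runs_within_While[where I = I, OF t(1)]) auto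
    then show ?thesis by (simp add: numeral_eq_Suc)
  qed
  have final: "\<exists>js. sorted_order {Suc a..n} x js \<and> holds_order js u \<and> length js = len"
    if I: "I d u" and w: "\<not> ivar u ''w'' < len" for d u
  proof (intro exI conjI)
    let ?js = "map (iarr u ''p'') [1..<Suc len]"
    have img: "iarr u ''p'' ` {1..len} = {Suc a..n}"
      using I by (simp add: I_def)
    then have "inj_on (iarr u ''p'') {1..len}"
      by (intro eq_card_imp_inj_on) (auto simp: len_def)
    moreover have "{1..len} = {1..<Suc len}" by auto
    ultimately have "distinct ?js" "set ?js = {Suc a..n}"
      using img by (simp_all add: distinct_map del: upt_Suc)
    moreover have "x (iarr u ''p'' i) \<le> x (iarr u ''p'' j)" if "1 \<le> i" "i \<le> j" "j \<le> len" for i j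
    proof -
      have "blocks_sorted x (iarr u ''p'') len (ivar u ''w'')" using I by (simp add: I_def)
      moreover have "0 * ivar u ''w'' < i \<and> i \<le> j \<and> j \<le> 0 * ivar u ''w'' + ivar u ''w'' \<and> j \<le> len"
        using w that by simp
      ultimately show ?thesis unfolding blocks_sorted_def by blast
    qed
    then have "sorted (map x ?js)"
      by (auto simp: sorted_iff_nth_mono simp del: upt_Suc)
    ultimately show "sorted_order {Suc a..n} x ?js"
      by (simp add: sorted_order_def del: upt_Suc)
    show "holds_order ?js u"
      by (auto simp: holds_order_def simp del: upt_Suc)
    show "length ?js = len" by simp
  qed
  have len: "len \<le> n" by (simp add: len_def)
  show ?thesis
    unfolding merge_sort_def seqs.simps x_def[symmetric] len_def[symmetric]
  proof (rule runs_within_straight_Seq[where B = "380 * (Suc n * Suc L)"],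
      simp, rule runs_within_Seq[OF id, where B' = "310 * (Suc n * Suc L)"])
    fix t assume t: "\<forall>i\<in>{1..len}. iarr t ''p'' i = i + a"
      "agree (written (for_to ''i'' ''len'' ?id)) ?s t"
    let ?t = "eff (ISet ''w'' (INum 1)) t"
    have "iarr t ''p'' ` {1..len} = (\<lambda>i. i + a) ` {1..len}"
      using t(1) by (intro image_cong) auto
    also have "\<dots> = {Suc a..n}"
      unfolding image_add_atLeastAtMost' by (auto simp: len_def)
    finally have I: "I L ?t"
      using L len unfolding I_def using blocks_sorted_singletons by auto
    show "runs_within (Seq (ISet ''w'' (INum 1))
         (Seq (While (ILess (IVar ''w'') (IVar ''len'')) merge_pass) SKIP)) t
       (310 * (Suc n * Suc L))
       (\<lambda>t. \<exists>js. sorted_order {Suc a..n} x js \<and> holds_order js t \<and>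
         ivar t ''len'' = len \<and> length js = len)"
    proof (rule runs_within_straight_Seq[where B = "305 * (Suc n * Suc L)"])
      have eqs: "rarr ?t ''x'' = x" "ivar ?t ''len'' = len"
        using t(2) n by (auto simp: agree_def x_def len_def)
      show "runs_within (Seq (While (ILess (IVar ''w'') (IVar ''len'')) merge_pass) SKIP) ?t
       (305 * (Suc n * Suc L))
       (\<lambda>t. \<exists>js. sorted_order {Suc a..n} x js \<and> holds_order js t \<and>
         ivar t ''len'' = len \<and> length js = len)"
      proof (rule runs_within_Seq[OF loop[OF I eqs], where B' = 1])
        fix u assume u: "(\<exists>d. I d u) \<and> \<not> ivar u ''w'' < ivar u ''len''"
          "agree (written (While (ILess (IVar ''w'') (IVar ''len'')) merge_pass)) ?t u"
        then have "ivar u ''len'' = len"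
          using eqs by (simp add: agree_def written_merge_pass)
        with u(1) final show "runs_within SKIP u 1 (\<lambda>t. \<exists>js. sorted_order {Suc a..n} x js \<and>
            holds_order js t \<and> ivar t ''len'' = len \<and> length js = len)"
          by (intro runs_within_straight) auto
      next
        have "4 + 300 * Suc len \<le> 304 * Suc n" using len by simp
        then have "(4 + 300 * Suc len) * Suc L + 1 \<le> 304 * Suc n * Suc L + Suc n * Suc L"
          by (intro add_mono mult_right_mono) auto
        also have "\<dots> = 305 * (Suc n * Suc L)" by (simp add: algebra_simps)
        finally show "(4 + 300 * Suc len) * Suc L + 1 \<le> 305 * (Suc n * Suc L)" .
      qed
    qed (auto)
  next
    have "(10 + 10) * Suc len \<le> 20 * (Suc n * Suc L)"
      using len by simp
    then show "(10 + 10) * Suc len + 310 * (Suc n * Suc L) \<le> 380 * (Suc n * Suc L)"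
      by linarith
  qed simp
qed

section \<open>The permutation inequalities\<close>

text \<open>The exchange argument: a bijection from \<open>A - J\<close> to \<open>J - A\<close> does not decrease \<open>x\<close>.\<close>

lemma sum_le_exchange:
  fixes x :: "'a \<Rightarrow> real"
  assumes "finite A" "finite J" "card A = card J"
    and le: "\<And>a b. a \<in> A - J \<Longrightarrow> b \<in> J - A \<Longrightarrow> x a \<le> x b"
  shows "sum x A \<le> sum x J"
proof -
  have "card (A - J) = card (J - A)"
    using assms(1-3) card_le_sym_Diff[of A J] card_le_sym_Diff[of J A] by simp
  then obtain h where h: "bij_betw h (A - J) (J - A)"
    using assms(1,2) finite_same_card_bij[of "A - J" "J - A"] by auto
  have "sum x (A - J) \<le> (\<Sum>a\<in>A - J. x (h a))"
    using bij_betwE[OF h] by (intro sum_mono le) auto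
  also have "\<dots> = sum x (J - A)"
    by (rule sum.reindex_bij_betw[OF h])
  finally have "sum x (A \<inter> J) + sum x (A - J) \<le> sum x (J \<inter> A) + sum x (J - A)"
    by (simp add: Int_commute)
  then show ?thesis
    using sum.Int_Diff[of A x J] sum.Int_Diff[of J x A] assms(1,2) by simp
qed

lemma sum_set_take:
  "distinct js \<Longrightarrow> m \<le> length js \<Longrightarrow> sum f (set (take m js)) = (\<Sum>i<m. f (js ! i))"
  by (subst sum.distinct_set_conv_list) (auto simp: sum_list_sum_nth atLeast0LessThan)

lemma prefix_minimal:
  assumes js: "sorted_order A x js" and J: "J \<subseteq> A" and m: "card J = m"
  shows "m \<le> length js" "card (set (take m js)) = m" "(\<Sum>i<m. x (js ! i)) \<le> sum x J"
proof -
  have fin: "finite A" "finite J" and d: "distinct js" and A: "set js = A"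
    and sorted: "sorted (map x js)"
    using js J by (auto simp: sorted_order_def finite_subset)
  have "card J \<le> card (set js)" using fin J A by (auto intro: card_mono)
  then show m_le: "m \<le> length js" using d m by (simp add: distinct_card)
  then show card: "card (set (take m js)) = m" using d by (simp add: distinct_card)
  have "sum x (set (take m js)) \<le> sum x J"
  proof (rule sum_le_exchange)
    fix a b assume a: "a \<in> set (take m js) - J" and b: "b \<in> J - set (take m js)"
    have "b \<in> set (take m js) \<union> set (drop m js)"
      using b J A by (metis DiffD1 append_take_drop_id set_append subsetD)
    moreover have "sorted (map x (take m js) @ map x (drop m js))"
      using sorted by (metis append_take_drop_id map_append)
    ultimately show "x a \<le> x b" using a b by (auto simp: sorted_append)
  qed (use fin card m in auto)
  then show "(\<Sum>i<m. x (js ! i)) \<le> sum x J"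
    using sum_set_take[OF d m_le] by metis
qed

lemma violated_perm_ineq:
  assumes "J \<subseteq> {1..n}"
  shows "violated n (perm_ineq v J) x \<longleftrightarrow> sum x J < (\<Sum>j = 1..card J. v j)"
proof -
  have "(\<Sum>i = 1..n. of_bool (i \<in> J) * x i) = sum x J"
    using assms by (simp add: Int_absorb1)
  then show ?thesis by (simp add: violated_def perm_ineq_def lhs_def)
qed

definition fails :: "(nat \<Rightarrow> real) \<Rightarrow> (nat \<Rightarrow> real) \<Rightarrow> nat list \<Rightarrow> nat \<Rightarrow> bool" where
  "fails v x js m \<longleftrightarrow> m \<in> {1..length js} \<and> (\<Sum>i<m. x (js ! i)) < (\<Sum>j = 1..m. v j)"

text \<open>The successive check for arbitrary \<open>v\<close>.  The right-hand side depends on the size only,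
  so the argument for \<open>v = (1, ..., n)\<close> carries over.\<close>

definition first_failure :: "(nat \<Rightarrow> real) \<Rightarrow> (nat \<Rightarrow> real) \<Rightarrow> nat list \<Rightarrow> ineq option" where
  "first_failure v x js =
     (if \<exists>m. fails v x js m
      then Some (perm_ineq v (set (take (LEAST m. fails v x js m) js)))
      else None)"

lemma prefix_violated:
  assumes js: "sorted_order {3..n} x js" and m: "m \<le> length js"
  shows "violated n (perm_ineq v (set (take m js))) x \<longleftrightarrow>
    (\<Sum>i<m. x (js ! i)) < (\<Sum>j = 1..m. v j)"
proof -
  have "distinct js" "set js = {3..n}" using js by (auto simp: sorted_order_def)
  then show ?thesis
    using m set_take_subset[of m js]
    by (subst violated_perm_ineq) (auto simp: sum_set_take distinct_card)
qed

text \<open>Among the sets of size \<open>m\<close> the prefix has the smallest left-hand side, and all of them share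
  the right-hand side.\<close>

lemma violated_imp_prefix_violated:
  assumes js: "sorted_order {3..n} x js"
    and J: "J \<noteq> {}" "J \<subseteq> {3..n}" "card J = m" "violated n (perm_ineq v J) x"
  shows "fails v x js m" "violated n (perm_ineq v (set (take m js))) x"
proof -
  have "finite J" using J(2) finite_subset by blast
  then have "1 \<le> m" using J(1,3) by (metis One_nat_def Suc_leI card_gt_0_iff)
  moreover have "sum x J < (\<Sum>j = 1..m. v j)"
    using J violated_perm_ineq[of J n v x] by fastforce
  ultimately show "fails v x js m"
    using prefix_minimal[OF js J(2,3)] by (simp add: fails_def)
  then show "violated n (perm_ineq v (set (take m js))) x"
    using prefix_violated[OF js] by (simp add: fails_def)
qed

lemma first_failure_correct:
  assumes js: "sorted_order {3..n} x js"
  shows "correct_answer n x (P n v) (first_failure v x js)"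
proof (cases "\<exists>m. fails v x js m")
  case True
  define m where "m = (LEAST m. fails v x js m)"
  have m: "fails v x js m" unfolding m_def using True by (rule LeastI_ex)
  let ?J = "set (take m js)"
  have "set js = {3..n}" using js by (simp add: sorted_order_def)
  then have "?J \<noteq> {}" "?J \<subseteq> {3..n}"
    using m set_take_subset[of m js] by (auto simp: fails_def)
  moreover have "violated n (perm_ineq v ?J) x"
    using m prefix_violated[OF js, of m v] by (simp add: fails_def)
  ultimately show ?thesis
    using True by (auto simp: correct_answer_def first_failure_def P_def m_def)
next
  case False
  then have "\<not> violated n (perm_ineq v J) x" if "J \<noteq> {}" "J \<subseteq> {3..n}" for J
    using violated_imp_prefix_violated(1)[OF js that refl] by blast
  with False show ?thesis
    by (auto simp: correct_answer_def first_failure_def P_def)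
qed

lemma sum_standard:
  assumes "standard n v" "m \<le> n"
  shows "(\<Sum>j = 1..m. v j) = 1/2 * real m * (real m + 1)"
proof -
  have "(\<Sum>j = 1..m. v j) = (\<Sum>j = 1..m. real j)"
    using assms by (intro sum.cong) (auto simp: standard_def)
  also have "\<dots> = 1/2 * real m * (real m + 1)"
    by (induction m) (auto simp: field_simps)
  finally show ?thesis .
qed

lemma perm_ineq_standard:
  assumes "standard n v" "card J \<le> n"
  shows "perm_ineq v J = perm_ineq real J"
  using sum_standard[OF assms] sum_standard[of n real "card J"] assms
  by (simp add: perm_ineq_def standard_def)

lemma first_failure_standard:
  assumes v: "standard n v" and js: "length js \<le> n"
  shows "first_failure v x js = successive_check x js"
proof -
  have eq: "fails v x js = check_fails x js"
  proof
    show "fails v x js m = check_fails x js m" for m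
      using sum_standard[OF v, of m] js by (auto simp: fails_def check_fails_def)
  qed
  have "card (set (take m js)) \<le> n" for m
    using card_length[of "take m js"] js by simp
  then show ?thesis
    unfolding first_failure_def successive_check_def eq
    using perm_ineq_standard[OF v] by simp
qed

definition prefix_step :: com where
  "prefix_step = If_then (Neg (ILess (INum 0) (IVar ''out''))) (seqs [
     RSet ''sx'' (RAdd (RVar ''sx'') (RElem ''x'' (IElem ''p'' (IVar ''k'')))),
     RSet ''sv'' (RAdd (RVar ''sv'') (RElem ''v'' (IVar ''k''))),
     If_then (RLess (RVar ''sx'') (RVar ''sv'')) (seqs [
       ISet ''out'' (INum 1), RSet ''out'' (RVar ''sv''), ISet ''m'' (IVar ''k'')])])"

text \<open>The variable \<open>m\<close> holds the length of the failing prefix and is 0 as long as there is none, in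
  which case the loop writing the coefficients does nothing.\<close>

definition prefix_scan :: com where
  "prefix_scan = Seq (for_to ''k'' ''len'' prefix_step)
     (for_to ''i'' ''m'' (RStore ''out'' (IElem ''p'' (IVar ''i'')) (RNat (INum 1))))"

lemma Least_first: "Q (m::nat) \<Longrightarrow> (\<And>l. l < m \<Longrightarrow> \<not> Q l) \<Longrightarrow> (LEAST m. Q m) = m"
  by (rule Least_equality) (use not_less in blast)+

lemma image_positions:
  assumes "holds_order js s" "m \<le> length js"
  shows "iarr s ''p'' ` {1..m} = set (take m js)"
proof -
  have "iarr s ''p'' ` {1..m} = (\<lambda>i. js ! (i - 1)) ` Suc ` {..<m}"
    using assms unfolding holds_order_def image_Suc_lessThan by (intro image_cong) auto
  also have "\<dots> = set (take m js)"
    unfolding image_image nth_image[OF assms(2), symmetric] by (simp add: atLeast0LessThan)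
  finally show ?thesis .
qed

lemma prefix_scan_correct:
  assumes js: "sorted_order {3..n} x js" "holds_order js s" "ivar s ''len'' = length js"
    and x: "\<And>i. i \<in> {1..n} \<Longrightarrow> rarr s ''x'' i = x i" and v: "\<And>i. i \<in> {1..n} \<Longrightarrow> rarr s ''v'' i = v i"
    and zero: "ivar s ''out'' = 0" "rarr s ''out'' = (\<lambda>_. 0)" "rvar s ''sx'' = 0" "rvar s ''sv'' = 0"
      "ivar s ''m'' = 0"
  shows "runs_within prefix_scan s (100 * Suc n) (\<lambda>t. result n ''out'' t = first_failure v x js)"
proof -
  have dist: "distinct js" and set: "set js = {3..n}" using js by (auto simp: sorted_order_def)
  have len: "length js \<le> n" using dist set distinct_card[of js] by simp
  define I where "I = (\<lambda>k (t::state). rarr t ''out'' = (\<lambda>_. 0) \<and>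
     (if ivar t ''out'' = 0
     then (\<forall>m\<le>k. \<not> fails v x js m) \<and> ivar t ''m'' = 0 \<and>
       rvar t ''sx'' = (\<Sum>i<k. x (js ! i)) \<and> rvar t ''sv'' = (\<Sum>j = 1..k. v j)
     else ivar t ''out'' = 1 \<and> fails v x js (ivar t ''m'') \<and>
       (\<forall>m<ivar t ''m''. \<not> fails v x js m) \<and> rvar t ''out'' = (\<Sum>j = 1..ivar t ''m''. v j)))"
  have scan: "runs_within (for_to ''k'' ''len'' prefix_step) s ((10 + 50) * Suc (length js)) (I (length js))"
  proof (rule runs_within_for_to)
    show "I 0 (s\<lparr>ivar := (ivar s)(''k'' := 0)\<rparr>)"
      using zero by (simp add: I_def fails_def)
  next
    fix k t assume t: "k < length js" "I k t" "agree (insert ''k'' (written prefix_step)) s t"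
    let ?t = "t\<lparr>ivar := (ivar t)(''k'' := Suc k)\<rparr>"
    have frame: "rarr t ''x'' = rarr s ''x''" "rarr t ''v'' = rarr s ''v''" "iarr t ''p'' = iarr s ''p''"
      using t(3) by (auto simp: agree_def prefix_step_def)
    have "js ! k \<in> {3..n}" using t(1) set nth_mem by blast
    then have "rarr t ''x'' (iarr t ''p'' (Suc k)) = x (js ! k)"
      using js(2) t(1) x frame by (auto simp: holds_order_def)
    moreover have "rarr t ''v'' (Suc k) = v (Suc k)"
      using t(1) len v frame by auto
    ultimately have eff: "eff prefix_step ?t = (if ivar t ''out'' = 0 then
        let sx = rvar t ''sx'' + x (js ! k); sv = rvar t ''sv'' + v (Suc k);
          u = ?t\<lparr>rvar := (rvar t)(''sx'' := sx, ''sv'' := sv)\<rparr>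
        in if sx < sv then u\<lparr>ivar := (ivar u)(''out'' := 1, ''m'' := Suc k),
            rvar := (rvar u)(''out'' := sv)\<rparr> else u
        else ?t)"
      by (simp add: prefix_step_def Let_def)
    have "I (Suc k) (eff prefix_step ?t)"
    proof (cases "ivar t ''out'' = 0")
      case True
      with t(2) have none: "\<And>m. m \<le> k \<Longrightarrow> \<not> fails v x js m" and "ivar t ''m'' = 0"
        and sx: "rvar t ''sx'' = (\<Sum>i<k. x (js ! i))" and sv: "rvar t ''sv'' = (\<Sum>j = 1..k. v j)"
        by (auto simp: I_def)
      moreover have "fails v x js (Suc k) \<longleftrightarrow>
          rvar t ''sx'' + x (js ! k) < rvar t ''sv'' + v (Suc k)"
        using t(1) by (simp add: fails_def sx sv)
      ultimately show ?thesis
        using True t(2) unfolding eff I_def by (auto simp: Let_def less_Suc_eq_le le_Suc_eq)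
    next
      case False
      with t(2) show ?thesis unfolding eff I_def by simp
    qed
    then show "runs_within prefix_step ?t 50 (I (Suc k))"
      by (intro runs_within_straight) (auto simp: prefix_step_def)
  qed (simp_all add: prefix_step_def js)
  let ?store = "RStore ''out'' (IElem ''p'' (IVar ''i'')) (RNat (INum 1))"
  have store: "runs_within (for_to ''i'' ''m'' ?store) t ((10 + 10) * Suc n)
      (\<lambda>t. result n ''out'' t = first_failure v x js)"
    if t: "I (length js) t" "agree (written (for_to ''k'' ''len'' prefix_step)) s t" for t
  proof -
    define m where "m = ivar t ''m''"
    have m_le: "m \<le> length js" using t(1) by (auto simp: I_def fails_def m_def split: if_splits)
    have frame: "iarr t ''p'' = iarr s ''p''" "rarr t ''out'' = (\<lambda>_. 0)"
      using t by (simp_all add: I_def agree_def prefix_step_def)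
    define J where "J = (\<lambda>k (u::state). ivar u ''out'' = ivar t ''out'' \<and> rvar u ''out'' = rvar t ''out'' \<and>
      rarr u ''out'' = (\<lambda>a. of_bool (a \<in> iarr s ''p'' ` {1..k})))"
    have "runs_within (for_to ''i'' ''m'' ?store) t ((10 + 10) * Suc m)
      (J m)"
    proof (rule runs_within_for_to)
      fix k u assume u: "J k u"
        "agree (insert ''i'' (written ?store)) t u"
      then have "iarr u ''p'' = iarr s ''p''" using frame by (auto simp: agree_def)
      moreover have "{1..Suc k} = insert (Suc k) {1..k}" by auto
      ultimately show "runs_within ?store (u\<lparr>ivar := (ivar u)(''i'' := Suc k)\<rparr>) 10
          (J (Suc k))"
        using u(1) by (intro runs_within_straight) (auto simp: J_def fun_eq_iff)
    qed (use frame in \<open>simp_all add: m_def J_def\<close>)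
    then show ?thesis
    proof (rule runs_within_mono)
      fix u assume u: "J m u"
      have out: "rarr u ''out'' = (\<lambda>a. of_bool (a \<in> set (take m js)))"
        using u(1) image_positions[OF js(2) m_le] by (simp add: J_def)
      have bound: "fails v x js m \<Longrightarrow> m \<le> length js" for m by (simp add: fails_def)
      have "set (take m js) \<subseteq> {1..n}" using set set_take_subset[of m js] by auto
      then have mask: "(\<lambda>i. if i \<in> {1..n} then of_bool (i \<in> set (take m js)) else (0::real))
          = (\<lambda>i. of_bool (i \<in> set (take m js)))"
        by (auto simp: fun_eq_iff)
      have card: "card (set (take m js)) = m"
        using dist m_le by (simp add: distinct_card)
      show "result n ''out'' u = first_failure v x js"
      proof (cases "ivar t ''out'' = 0")
        case True
        then have none: "\<forall>m\<le>length js. \<not> fails v x js m" using t(1) by (simp add: I_def)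
        have "\<not> fails v x js l" for l using none bound by blast
        moreover have "ivar u ''out'' = 0" using True u by (simp add: J_def)
        ultimately show ?thesis by (simp add: result_def first_failure_def)
      next
        case False
        with t(1) have I: "ivar t ''out'' = 1" "fails v x js m" "\<forall>l<m. \<not> fails v x js l"
          "rvar t ''out'' = (\<Sum>j = 1..m. v j)"
          by (simp_all add: I_def m_def)
        from I have "(LEAST m. fails v x js m) = m"
          by (intro Least_first) auto
        with I(2) have "first_failure v x js = Some (perm_ineq v (set (take m js)))"
          unfolding first_failure_def by metis
        moreover have "ivar u ''out'' = 1" "rvar u ''out'' = (\<Sum>j = 1..m. v j)"
          using u I by (simp_all add: J_def)
        ultimately show ?thesis
          unfolding result_def perm_ineq_def out mask card by simp
      qed
    qed (use m_le len in auto)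
  qed
  show ?thesis
    unfolding prefix_scan_def
    by (rule runs_within_Seq[OF scan store]) (use len in auto)
qed

section \<open>Selecting the smallest entries\<close>

text \<open>\<open>S\<close> is what a pass through the first \<open>k\<close> elements of \<open>js\<close> has picked from \<open>A\<close> when it stops
  picking after \<open>r\<close> elements.  The last conjunct already compares with all of \<open>A\<close>, including
  elements that the pass has not yet met.\<close>

definition greedy :: "(nat \<Rightarrow> real) \<Rightarrow> nat list \<Rightarrow> nat set \<Rightarrow> nat \<Rightarrow> nat \<Rightarrow> nat set \<Rightarrow> bool" where
  "greedy x js A r k S \<longleftrightarrow> S \<subseteq> A \<inter> set (take k js) \<and> card S \<le> r \<and>
     (card S < r \<longrightarrow> S = A \<inter> set (take k js)) \<and> (\<forall>a\<in>S. \<forall>b\<in>A - S. x a \<le> x b)"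

lemma greedy_0: "greedy x js A r 0 {}"
  by (simp add: greedy_def)

text \<open>All of \<open>A\<close> that came earlier has been picked, so what is left of \<open>A\<close> comes later in the sorted
  order.\<close>

lemma greedy_take:
  assumes js: "sorted_order B x js" and A: "A \<subseteq> B" and k: "k < length js"
    and S: "greedy x js A r k S" "card S < r" and j: "js ! k \<in> A"
  shows "greedy x js A r (Suc k) (insert (js ! k) S)" "js ! k \<notin> S"
proof -
  have d: "distinct js" and sorted: "sorted (map x js)" and B: "set js = B"
    using js by (auto simp: sorted_order_def)
  have S_eq: "S = A \<inter> set (take k js)" using S by (auto simp: greedy_def)
  have take: "set (take (Suc k) js) = insert (js ! k) (set (take k js))"
    using k by (simp add: take_Suc_conv_app_nth)
  show new: "js ! k \<notin> S"
    using d k unfolding S_eq by (auto simp: in_set_conv_nth nth_eq_iff_index_eq)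
  have "x (js ! k) \<le> x b" if b: "b \<in> A - insert (js ! k) S" for b
  proof -
    have "b \<in> set js" using b A B by auto
    then obtain l where l: "l < length js" "b = js ! l" by (auto simp: in_set_conv_nth)
    have "\<not> l < k"
      using b l k S_eq by (auto simp: in_set_conv_nth)
    then show ?thesis
      using l k sorted_nth_mono[OF sorted, of k l] by simp
  qed
  moreover have "finite S" unfolding S_eq by simp
  ultimately show "greedy x js A r (Suc k) (insert (js ! k) S)"
    using S new j take S_eq by (auto simp: greedy_def)
qed

lemma greedy_skip:
  assumes "k < length js" "greedy x js A r k S" "card S \<ge> r \<or> js ! k \<notin> A"
  shows "greedy x js A r (Suc k) S"
  using assms by (auto simp: greedy_def take_Suc_conv_app_nth)

text \<open>If the pass ends with fewer than \<open>r\<close> elements, it has picked all of \<open>A\<close>, and then \<open>A\<close> has no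
  subset of size \<open>r\<close>.\<close>

lemma greedy_optimal:
  assumes js: "sorted_order B x js" and A: "A \<subseteq> B" and S: "greedy x js A r (length js) S"
    and L: "L \<subseteq> A" "card L = r"
  shows "card S = r" "sum x S \<le> sum x L"
proof -
  have B: "set js = B" using js by (simp add: sorted_order_def)
  then have fin: "finite A" "finite S" "finite L"
    using A S L by (auto simp: greedy_def intro: finite_subset)
  have "\<not> card S < r"
  proof
    assume "card S < r"
    then have "S = A" using S B A by (auto simp: greedy_def)
    with \<open>card S < r\<close> L fin show False using card_mono[of A L] by simp
  qed
  with S show card: "card S = r" by (auto simp: greedy_def)
  show "sum x S \<le> sum x L"
    using S L fin card by (intro sum_le_exchange) (auto simp: greedy_def)
qed

section \<open>The inequalities of levels 0, 1 and 2\<close>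

text \<open>The numbers in which the families differ: the coefficients of \<open>x (m - 1)\<close>, of \<open>x m\<close> and of the
  entries in the chosen set, which has size \<open>m - deficit\<close>; the right-hand side
  \<open>(quad * m^2 + (lin - neglin) * m + const) / 2\<close>; and the range of \<open>m\<close>, from \<open>lowest\<close> up to
  \<open>(n + shift) div 2\<close> and \<open>n - gap\<close>.  All are natural because programs only contain natural
  constants.\<close>

record shape =
  coeff_before :: nat
  coeff_at :: nat
  coeff_after :: nat
  deficit :: nat
  quad :: nat
  lin :: nat
  neglin :: nat
  const :: nat
  lowest :: nat
  shift :: nat
  gap :: nat

definition shape_rhs :: "shape \<Rightarrow> nat \<Rightarrow> real" where
  "shape_rhs sh m = (real (quad sh) * real m * real m + real (lin sh) * real m
     - real (neglin sh) * real m + real (const sh)) / 2"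

definition shape_ineq :: "shape \<Rightarrow> nat \<Rightarrow> nat set \<Rightarrow> ineq" where
  "shape_ineq sh m L = Ineq (\<lambda>k. real (coeff_before sh) * of_bool (k = m - 1)
       + real (coeff_at sh) * of_bool (k = m) + real (coeff_after sh) * of_bool (k \<in> L))
     Ge (shape_rhs sh m)"

definition shape_ineqs :: "shape \<Rightarrow> nat \<Rightarrow> nat \<Rightarrow> ineq set" where
  "shape_ineqs sh n m = {shape_ineq sh m L | L. L \<subseteq> {m+1..n} \<and> card L = m - deficit sh}"

definition shape_range :: "shape \<Rightarrow> nat \<Rightarrow> nat set" where
  "shape_range sh n = {m. lowest sh \<le> m \<and> m \<le> (n + shift sh) div 2 \<and> m + gap sh \<le> n}"

definition rhs_exp :: "shape \<Rightarrow> rexp" where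
  "rhs_exp sh = (let c = \<lambda>k. RNat (INum k); m = RNat (IVar ''m'') in
     RDiv (RAdd (RSub (RAdd (RMul (RMul (c (quad sh)) m) m) (RMul (c (lin sh)) m))
       (RMul (c (neglin sh)) m)) (c (const sh))) (c 2))"

definition pick_step :: "string \<Rightarrow> shape \<Rightarrow> com" where
  "pick_step y sh = If_then (Conj (ILess (IVar ''m'') (IElem ''p'' (IVar ''i'')))
       (ILess (IVar ''cnt'') (ISub (IVar ''m'') (INum (deficit sh)))))
     (seqs [ISet ''cnt'' (IAdd (IVar ''cnt'') (INum 1)),
       RStore y (IElem ''p'' (IVar ''i'')) (RNat (INum (coeff_after sh))),
       RSet ''s'' (RAdd (RVar ''s'') (RMul (RNat (INum (coeff_after sh)))
         (RElem ''x'' (IElem ''p'' (IVar ''i'')))))])"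

definition start_picks :: "string \<Rightarrow> shape \<Rightarrow> com" where
  "start_picks y sh = (let m0 = ISub (IVar ''m'') (INum 1); m1 = IVar ''m'';
       a = RNat (INum (coeff_before sh)); b = RNat (INum (coeff_at sh)) in
     seqs [RStore y m0 a, RStore y m1 b,
       RSet ''s'' (RAdd (RMul a (RElem ''x'' m0)) (RMul b (RElem ''x'' m1))),
       ISet ''cnt'' (INum 0)])"

definition report :: "string \<Rightarrow> shape \<Rightarrow> com" where
  "report y sh = If_then
     (Conj (Neg (ILess (IVar ''cnt'') (ISub (IVar ''m'') (INum (deficit sh)))))
       (RLess (RVar ''s'') (rhs_exp sh)))
     (seqs [ISet y (INum 1), RSet y (rhs_exp sh)])"

definition level_step :: "string \<Rightarrow> shape \<Rightarrow> com" where
  "level_step y sh = seqs [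
     for_to ''i'' ''n'' (RStore y (IVar ''i'') (RNat (INum 0))),
     start_picks y sh,
     for_to ''i'' ''n'' (pick_step y sh),
     report y sh]"

lemmas level_step_defs = pick_step_def start_picks_def report_def rhs_exp_def Let_def

definition reserved :: "string set" where
  "reserved = {''n'', ''m'', ''i'', ''cnt'', ''s'', ''x'', ''p''}"

lemma written_level_step: "written (level_step y sh) = {''i'', ''cnt'', ''s'', y}"
  by (auto simp: level_step_def level_step_defs)

lemma rval_rhs_exp: "ivar t ''m'' = m \<Longrightarrow> rval (rhs_exp sh) t = shape_rhs sh m"
  by (simp add: rhs_exp_def shape_rhs_def Let_def)

lemma lhs_shape_ineq:
  assumes "2 \<le> m" "m \<le> n" "L \<subseteq> {m+1..n}"
  shows "lhs n (shape_ineq sh m L) x = real (coeff_before sh) * x (m - 1)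
    + real (coeff_at sh) * x m + real (coeff_after sh) * sum x L"
proof -
  have "(\<Sum>k = 1..n. of_bool (k \<in> L) * x k) = sum x ({1..n} \<inter> L)"
    by simp
  also have "{1..n} \<inter> L = L" using assms(3) by auto
  finally have L: "(\<Sum>k = 1..n. of_bool (k \<in> L) * x k) = sum x L" .
  have single: "(\<Sum>k = 1..n. of_bool (k = i) * x k) = x i" if "i \<in> {1..n}" for i
    using that by (simp add: of_bool_def if_distrib[of "\<lambda>c. c * _"] cong: if_cong)
  have "lhs n (shape_ineq sh m L) x =
      real (coeff_before sh) * (\<Sum>k = 1..n. of_bool (k = m - 1) * x k)
    + real (coeff_at sh) * (\<Sum>k = 1..n. of_bool (k = m) * x k)
    + real (coeff_after sh) * (\<Sum>k = 1..n. of_bool (k \<in> L) * x k)"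
    by (simp add: lhs_def shape_ineq_def distrib_right sum.distrib sum_distrib_left mult.assoc
        del: sum_of_bool_mult_eq)
  moreover have "m - 1 \<in> {1..n}" "m \<in> {1..n}" using assms(1,2) by auto
  ultimately show ?thesis
    by (simp only: L single)
qed

lemma result_SomeI:
  assumes "ivar s y = (case sense_of I of Ge \<Rightarrow> 1 | Le \<Rightarrow> 2)" "rvar s y = rhs I"
    "\<And>i. i \<in> {1..n} \<Longrightarrow> rarr s y i = coeffs I i" "\<And>i. i \<notin> {1..n} \<Longrightarrow> coeffs I i = 0"
  shows "result n y s = Some I"
proof -
  have "(\<lambda>i. if i \<in> {1..n} then rarr s y i else 0) = coeffs I"
    using assms(3,4) by (auto simp: fun_eq_iff)
  then show ?thesis
    using assms(1,2) unfolding result_def by (cases I) (auto split: sense.splits)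
qed

text \<open>The chosen coefficient is nonnegative, so the left-hand side is smallest at the greedy set;
  if that inequality is satisfied, so is every other one.\<close>

lemma level_step_correct:
  fixes n m :: nat and sh :: shape
  assumes js: "sorted_order {1..n} x js" "holds_order js s" and m: "2 \<le> m" "m \<le> n"
    and s: "ivar s ''n'' = n" "ivar s ''m'' = m" "\<And>i. i \<in> {1..n} \<Longrightarrow> rarr s ''x'' i = x i"
    and y: "y \<notin> reserved" "ivar s y = 0"
  shows "runs_within (level_step y sh) s (300 * Suc n)
    (\<lambda>t. correct_answer n x (shape_ineqs sh n m) (result n y t))"
proof -
  let ?A = "{m+1..n}" and ?r = "m - deficit sh"
  let ?clear = "RStore y (IVar ''i'') (RNat (INum 0))"
  have y': "y \<noteq> ''n''" "y \<noteq> ''m''" "y \<noteq> ''i''" "y \<noteq> ''cnt''" "y \<noteq> ''s''" "y \<noteq> ''x''" "y \<noteq> ''p''"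
    using y(1) by (auto simp: reserved_def)
  have len: "length js = n"
    using js(1) distinct_card[of js] by (simp add: sorted_order_def)
  define lhs' where "lhs' = (\<lambda>S. real (coeff_before sh) * x (m - 1)
    + real (coeff_at sh) * x m + real (coeff_after sh) * sum x S)"
  define I where "I = (\<lambda>k (t::state). ivar t y = 0 \<and> (\<exists>S. greedy x js ?A ?r k S \<and>
     ivar t ''cnt'' = card S \<and> rvar t ''s'' = lhs' S \<and>
     (\<forall>i\<in>{1..n}. rarr t y i = coeffs (shape_ineq sh m S) i)))"
  have clear: "runs_within (for_to ''i'' ''n'' ?clear) s ((10 + 10) * Suc n)
      (\<lambda>t. ivar t y = 0 \<and> (\<forall>i\<in>{1..n}. rarr t y i = 0))"
    by (rule runs_within_for_to[where I = "\<lambda>k t. ivar t y = 0 \<and> (\<forall>i\<in>{1..k}. rarr t y i = 0)"])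
      (auto intro!: runs_within_straight simp: s y y' le_Suc_eq)
  have pick: "runs_within (for_to ''i'' ''n'' (pick_step y sh)) t ((10 + 60) * Suc n) (I n)"
    if t: "I 0 t" "agree {''i'', ''cnt'', ''s'', y} s t" for t
  proof (rule runs_within_for_to)
    show "n = ivar t ''n''" using t(2) s(1) y' by (simp add: agree_def)
    show "I 0 (t\<lparr>ivar := (ivar t)(''i'' := 0)\<rparr>)"
      using t(1) y' by (simp add: I_def)
  next
    fix k u assume k: "k < n" and Iu: "I k u"
      and "agree (insert ''i'' (written (pick_step y sh))) t u"
    then have "agree {''i'', ''cnt'', ''s'', y} s u"
      using t(2) by (auto simp: agree_def level_step_defs)
    then have frame: "ivar u ''m'' = m" "rarr u ''x'' = rarr s ''x''" "iarr u ''p'' = iarr s ''p''"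
      using y' s(2) by (simp_all add: agree_def)
    let ?u = "u\<lparr>ivar := (ivar u)(''i'' := Suc k)\<rparr>" and ?j = "js ! k"
    have j: "?j \<in> {1..n}"
      using js(1) k len nth_mem[of k js] unfolding sorted_order_def by blast
    have p: "iarr u ''p'' (Suc k) = ?j"
      using js(2) k len frame by (simp add: holds_order_def)
    obtain S where S: "greedy x js ?A ?r k S" "ivar u ''cnt'' = card S" "rvar u ''s'' = lhs' S"
      "\<forall>i\<in>{1..n}. rarr u y i = coeffs (shape_ineq sh m S) i" and "ivar u y = 0"
      using Iu by (auto simp: I_def)
    have "I (Suc k) (eff (pick_step y sh) ?u)"
    proof (cases "m < ?j \<and> card S < ?r")
      case True
      then have take: "greedy x js ?A ?r (Suc k) (insert ?j S)" "?j \<notin> S"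
        using greedy_take[OF js(1) _ _ S(1)] k len j by auto
      have fin: "finite S" using S(1) finite_subset by (fastforce simp: greedy_def)
      have "S \<subseteq> ?A" using S(1) by (auto simp: greedy_def)
      have x: "rarr s ''x'' ?j = x ?j" using s(3) j by simp
      have "eff (pick_step y sh) ?u = ?u\<lparr>ivar := (ivar ?u)(''cnt'' := Suc (card S)),
          rarr := (rarr u)(y := (rarr u y)(?j := real (coeff_after sh))),
          rvar := (rvar u)(''s'' := lhs' S + real (coeff_after sh) * x ?j)\<rparr>"
        using True S(2,3) p frame y' x by (simp add: pick_step_def)
      moreover have "lhs' S + real (coeff_after sh) * x ?j = lhs' (insert ?j S)"
        using take(2) fin by (simp add: lhs'_def algebra_simps)
      moreover have "\<forall>i\<in>{1..n}. ((rarr u y)(?j := real (coeff_after sh))) i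
          = coeffs (shape_ineq sh m (insert ?j S)) i"
        using S(4) True take(2) by (auto simp: shape_ineq_def)
      ultimately show ?thesis
        using take fin \<open>ivar u y = 0\<close> y' unfolding I_def
        by (auto intro!: exI[of _ "insert ?j S"])
    next
      case False
      then have "greedy x js ?A ?r (Suc k) S"
        using k len S(1) by (intro greedy_skip) auto
      moreover have "eff (pick_step y sh) ?u = ?u"
        using False S(2) p frame y' by (auto simp: pick_step_def)
      ultimately show ?thesis
        using S \<open>ivar u y = 0\<close> y' unfolding I_def by auto
    qed
    then show "runs_within (pick_step y sh) ?u 60 (I (Suc k))"
      by (intro runs_within_straight) (auto simp: pick_step_def)
  qed (use y' in \<open>auto simp: level_step_defs\<close>)
  have final: "correct_answer n x (shape_ineqs sh n m) (result n y (eff (report y sh) t))"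
    if t: "I n t" "ivar t ''m'' = m" for t
  proof -
    obtain S where S: "greedy x js ?A ?r n S" "ivar t ''cnt'' = card S" "rvar t ''s'' = lhs' S"
      "\<forall>i\<in>{1..n}. rarr t y i = coeffs (shape_ineq sh m S) i" and y0: "ivar t y = 0"
      using t(1) by (auto simp: I_def)
    have S_sub: "S \<subseteq> ?A" using S(1) by (auto simp: greedy_def)
    have viol: "violated n (shape_ineq sh m L) x \<longleftrightarrow> lhs' L < shape_rhs sh m" if "L \<subseteq> ?A" for L
      unfolding violated_def lhs_shape_ineq[OF m that] lhs'_def by (simp add: shape_ineq_def)
    show ?thesis
    proof (cases "\<not> card S < ?r \<and> lhs' S < shape_rhs sh m")
      case True
      then have "card S = ?r" using S(1) by (auto simp: greedy_def)
      then have "shape_ineq sh m S \<in> shape_ineqs sh n m"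
        using S_sub by (auto simp: shape_ineqs_def)
      moreover have "violated n (shape_ineq sh m S) x" using viol[OF S_sub] True by simp
      moreover have "result n y (eff (report y sh) t) = Some (shape_ineq sh m S)"
        using True S(2-4) S_sub m t(2) y'
        by (intro result_SomeI) (auto simp: report_def rval_rhs_exp shape_ineq_def)
      ultimately show ?thesis by (simp add: correct_answer_def)
    next
      case False
      then have "result n y (eff (report y sh) t) = None"
        using S(2,3) t(2) y0 by (auto simp: report_def result_def rval_rhs_exp)
      moreover have "\<not> violated n (shape_ineq sh m L) x" if L: "L \<subseteq> ?A" "card L = ?r" for L
      proof -
        have "?A \<subseteq> {1..n}" by auto
        then have "card S = ?r" "sum x S \<le> sum x L"
          using greedy_optimal[OF js(1) _ _ L, of S] S(1) len by auto
        then have "lhs' S \<le> lhs' L" by (simp add: lhs'_def mult_left_mono)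
        with False \<open>card S = ?r\<close> viol[OF L(1)] show ?thesis by auto
      qed
      ultimately show ?thesis
        by (auto simp: correct_answer_def shape_ineqs_def)
    qed
  qed
  show ?thesis
    unfolding level_step_def seqs.simps
  proof (rule runs_within_Seq[OF clear, where B' = "280 * Suc n"])
    fix t assume t: "ivar t y = 0 \<and> (\<forall>i\<in>{1..n}. rarr t y i = 0)"
      "agree (written (for_to ''i'' ''n'' ?clear)) s t"
    let ?t = "eff (start_picks y sh) t"
    have "m \<in> {1..n}" "m - 1 \<in> {1..n}" using m by auto
    then have "rarr s ''x'' m = x m" "rarr s ''x'' (m - 1) = x (m - 1)" by (auto intro: s(3))
    moreover have "ivar t ''m'' = m" "rarr t ''x'' = rarr s ''x''"
      using t(2) s(2) y' by (simp_all add: agree_def)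
    ultimately have "I 0 ?t"
      using t(1) y' unfolding I_def
      by (auto intro!: exI[of _ "{}"] greedy_0 simp: start_picks_def shape_ineq_def lhs'_def Let_def)
    moreover have "agree {''i'', ''cnt'', ''s'', y} s ?t"
      using t(2) by (auto simp: agree_def start_picks_def Let_def)
    ultimately have pick': "runs_within (for_to ''i'' ''n'' (pick_step y sh)) ?t ((10 + 60) * Suc n)
        (I n)" and ag: "agree {''i'', ''cnt'', ''s'', y} s ?t"
      using pick by blast+
    show "runs_within (Seq (start_picks y sh) (Seq (for_to ''i'' ''n'' (pick_step y sh))
        (Seq (report y sh) SKIP))) t (280 * Suc n)
      (\<lambda>t. correct_answer n x (shape_ineqs sh n m) (result n y t))"
    proof (rule runs_within_straight_Seq[where B = "240 * Suc n"])
      show "runs_within (Seq (for_to ''i'' ''n'' (pick_step y sh)) (Seq (report y sh) SKIP)) ?t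
          (240 * Suc n) (\<lambda>t. correct_answer n x (shape_ineqs sh n m) (result n y t))"
      proof (rule runs_within_Seq[OF pick', where B' = 100])
        fix u assume u: "I n u" "agree (written (for_to ''i'' ''n'' (pick_step y sh))) ?t u"
        have "ivar ?t ''m'' = m" using ag s(2) y' by (simp add: agree_def)
        then have "ivar u ''m'' = m" using u(2) y' by (simp add: agree_def pick_step_def)
        then show "runs_within (Seq (report y sh) SKIP) u 100
            (\<lambda>t. correct_answer n x (shape_ineqs sh n m) (result n y t))"
          using final[OF u(1)]
          by (intro runs_within_straight) (auto simp: report_def rhs_exp_def Let_def)
      qed simp
    qed (auto simp: start_picks_def Let_def)
  qed simp
qed

lemma result_agree: "agree W s t \<Longrightarrow> y \<notin> W \<Longrightarrow> result n y t = result n y s"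
  unfolding result_def agree_def by (elim allE[of _ y]) (simp only: simp_thms)

text \<open>Once a violated inequality has been found, its slot must not be overwritten, whence the last
  conjunct of the guard.\<close>

definition level_loop :: "string \<Rightarrow> shape \<Rightarrow> com" where
  "level_loop y sh = for_to ''m'' ''n'' (If_then
     (Conj (Neg (ILess (IVar ''m'') (INum (lowest sh))))
     (Conj (Neg (ILess (IHalf (IAdd (IVar ''n'') (INum (shift sh)))) (IVar ''m'')))
     (Conj (Neg (ILess (IVar ''n'') (IAdd (IVar ''m'') (INum (gap sh)))))
       (Neg (ILess (INum 0) (IVar y))))))
     (level_step y sh))"

definition shape_family :: "shape \<Rightarrow> nat \<Rightarrow> ineq set" where
  "shape_family sh n = (\<Union>m\<in>shape_range sh n. shape_ineqs sh n m)"

lemma level_loop_correct: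
  fixes n :: nat and sh :: shape
  assumes js: "sorted_order {1..n} x js" "holds_order js s" and low: "2 \<le> lowest sh"
    and s: "ivar s ''n'' = n" "\<And>i. i \<in> {1..n} \<Longrightarrow> rarr s ''x'' i = x i"
    and y: "y \<notin> reserved" "ivar s y = 0"
  shows "runs_within (level_loop y sh) s (400 * (Suc n * Suc n))
    (\<lambda>t. correct_answer n x (shape_family sh n) (result n y t))"
proof -
  define F where "F = (\<lambda>k. \<Union>m\<in>shape_range sh n \<inter> {..k}. shape_ineqs sh n m)"
  let ?b = "Conj (Neg (ILess (IVar ''m'') (INum (lowest sh))))
     (Conj (Neg (ILess (IHalf (IAdd (IVar ''n'') (INum (shift sh)))) (IVar ''m'')))
     (Conj (Neg (ILess (IVar ''n'') (IAdd (IVar ''m'') (INum (gap sh)))))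
       (Neg (ILess (INum 0) (IVar y)))))"
  have y': "y \<noteq> ''n''" "y \<noteq> ''m''" "y \<noteq> ''x''" "y \<noteq> ''p''"
    using y(1) by (auto simp: reserved_def)
  have F_Suc: "F (Suc k) = F k \<union> (if Suc k \<in> shape_range sh n then shape_ineqs sh n (Suc k) else {})" for k
    by (auto simp: F_def le_Suc_eq)
  have "runs_within (level_loop y sh) s ((10 + (30 + 300 * Suc n)) * Suc n)
      (\<lambda>t. correct_answer n x (F n) (result n y t))"
    unfolding level_loop_def
  proof (rule runs_within_for_to[where I = "\<lambda>k t. correct_answer n x (F k) (result n y t)"])
    have "F 0 = {}" using low by (auto simp: F_def shape_range_def)
    then show "correct_answer n x (F 0) (result n y (s\<lparr>ivar := (ivar s)(''m'' := 0)\<rparr>))"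
      using y(2) y' by (simp add: correct_answer_def result_def)
  next
    fix k t assume k: "k < n" and t: "correct_answer n x (F k) (result n y t)"
      "agree (insert ''m'' (written (If_then ?b (level_step y sh)))) s t"
    let ?t = "t\<lparr>ivar := (ivar t)(''m'' := Suc k)\<rparr>"
    have frame: "ivar t ''n'' = n" "rarr t ''x'' = rarr s ''x''" "iarr t ''p'' = iarr s ''p''"
      using t(2) s(1) y' by (simp_all add: agree_def written_level_step)
    have res: "result n y ?t = result n y t"
      using y' by (intro result_agree[of "{''m''}"] agree_set_ivar) auto
    have b: "bval ?b ?t \<longleftrightarrow> Suc k \<in> shape_range sh n \<and> ivar t y = 0"
      using frame y' by (auto simp: shape_range_def)
    show "runs_within (If_then ?b (level_step y sh)) ?t (30 + 300 * Suc n)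
      (\<lambda>t. correct_answer n x (F (Suc k)) (result n y t))"
    proof (rule runs_within_Cond)
      assume "bval ?b ?t"
      with b have range: "Suc k \<in> shape_range sh n" and y0: "ivar t y = 0" by auto
      have "2 \<le> Suc k" using range low by (simp add: shape_range_def)
      moreover have "holds_order js ?t" using js(2) frame by (simp add: holds_order_def)
      ultimately have "runs_within (level_step y sh) ?t (300 * Suc n)
          (\<lambda>t. correct_answer n x (shape_ineqs sh n (Suc k)) (result n y t))"
        using js(1) frame k s y(1) y' y0 by (intro level_step_correct) auto
      then show "runs_within (level_step y sh) ?t (300 * Suc n)
          (\<lambda>t. correct_answer n x (F (Suc k)) (result n y t))"
        using t(1) y0 range
        by (elim runs_within_mono)
          (auto simp: correct_answer_def F_Suc result_def split: option.splits)
    next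
      assume "\<not> bval ?b ?t"
      with b have "correct_answer n x (F (Suc k)) (result n y ?t)"
        using t(1) by (auto simp: res correct_answer_def F_Suc result_def[of n y t] split: option.splits)
      then show "runs_within SKIP ?t (300 * Suc n)
          (\<lambda>t. correct_answer n x (F (Suc k)) (result n y t))"
        by (intro runs_within_straight) auto
    qed simp
  qed (use s(1) y' in \<open>auto simp: written_level_step\<close>)
  moreover have "F n = shape_family sh n"
    by (auto simp: F_def shape_family_def shape_range_def)
  ultimately show ?thesis
    by (elim runs_within_mono) (simp_all add: algebra_simps)
qed

definition level_loops :: "(string \<times> shape) list \<Rightarrow> com" where
  "level_loops ys = seqs (map (\<lambda>(y, sh). level_loop y sh) ys)"

lemma written_level_loops: "written (level_loops ys) \<subseteq> {''m'', ''i'', ''cnt'', ''s''} \<union> fst ` set ys"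
  by (induction ys) (auto simp: level_loops_def level_loop_def written_level_step)

lemma level_loops_correct:
  fixes n :: nat
  assumes js: "sorted_order {1..n} x js"
    and ys: "distinct (map fst ys)" "\<forall>(y, sh)\<in>set ys. y \<notin> reserved \<and> 2 \<le> lowest sh"
    and s: "holds_order js s" "ivar s ''n'' = n" "\<And>i. i \<in> {1..n} \<Longrightarrow> rarr s ''x'' i = x i"
      "\<forall>y\<in>fst ` set ys. ivar s y = 0"
  shows "runs_within (level_loops ys) s (Suc (400 * length ys * (Suc n * Suc n)))
    (\<lambda>t. \<forall>(y, sh)\<in>set ys. correct_answer n x (shape_family sh n) (result n y t))"
  using ys s
proof (induction ys arbitrary: s)
  case Nil
  then show ?case by (intro runs_within_straight) (auto simp: level_loops_def)
next
  case (Cons p ys)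
  obtain y sh where p: "p = (y, sh)" by force
  let ?Q = "\<lambda>t. correct_answer n x (shape_family sh n) (result n y t)"
  have y: "y \<notin> reserved" "2 \<le> lowest sh" "y \<notin> fst ` set ys"
    using Cons.prems(1,2) by (auto simp: p)
  have first: "runs_within (level_loop y sh) s (400 * (Suc n * Suc n)) ?Q"
    using Cons.prems by (intro level_loop_correct[OF js]) (auto simp: p)
  have "runs_within (Seq (level_loop y sh) (level_loops ys)) s (Suc (400 * length (p # ys) * (Suc n * Suc n)))
    (\<lambda>t. \<forall>(y, sh)\<in>set (p # ys). correct_answer n x (shape_family sh n) (result n y t))"
  proof (rule runs_within_Seq[OF first])
    fix t assume t: "?Q t" "agree (written (level_loop y sh)) s t"
    then have ag: "agree {''m'', ''i'', ''cnt'', ''s'', y} s t"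
      by (simp add: level_loop_def written_level_step insert_commute)
    have other: "z \<notin> {''m'', ''i'', ''cnt'', ''s'', y}" if z: "z \<in> fst ` set ys" for z
    proof -
      obtain sh' where "(z, sh') \<in> set ys" using z by auto
      then have "z \<notin> reserved" using Cons.prems(2) by auto
      moreover have "z \<noteq> y" using z y(3) by auto
      ultimately show ?thesis by (simp add: reserved_def)
    qed
    have "runs_within (level_loops ys) t (Suc (400 * length ys * (Suc n * Suc n)))
      (\<lambda>t. \<forall>(y, sh)\<in>set ys. correct_answer n x (shape_family sh n) (result n y t))"
    proof (rule Cons.IH)
      show "holds_order js t" "ivar t ''n'' = n" "\<And>i. i \<in> {1..n} \<Longrightarrow> rarr t ''x'' i = x i"
        using Cons.prems(3-5) ag y(1) by (auto simp: holds_order_def agree_def reserved_def)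
      show "\<forall>z\<in>fst ` set ys. ivar t z = 0"
        using Cons.prems(6) ag other by (auto simp: agree_def)
    qed (use Cons.prems in auto)
    then show "runs_within (level_loops ys) t (Suc (400 * length ys * (Suc n * Suc n)))
      (\<lambda>t. \<forall>(y, sh)\<in>set (p # ys). correct_answer n x (shape_family sh n) (result n y t))"
    proof (rule runs_within_conj_agree)
      fix u assume u: "\<forall>(y, sh)\<in>set ys. correct_answer n x (shape_family sh n) (result n y u)"
        "agree (written (level_loops ys)) t u"
      have "y \<notin> written (level_loops ys)"
        using written_level_loops[of ys] y by (auto simp: reserved_def)
      with u t(1) result_agree show
        "\<forall>(y, sh)\<in>set (p # ys). correct_answer n x (shape_family sh n) (result n y u)"
        by (auto simp: p)
    qed simp
  qed (simp add: algebra_simps)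
  then show ?case by (simp add: level_loops_def p)
qed

definition level0_shape :: shape where
  "level0_shape = \<lparr>coeff_before = 0, coeff_at = 0, coeff_after = 1, deficit = 0,
     quad = 1, lin = 1, neglin = 0, const = 0, lowest = 2, shift = 0, gap = 0\<rparr>"

text \<open>A \<open>shift\<close> of 1 or 2 encodes the upper end \<open>\<lceil>n / 2\<rceil>\<close> or \<open>\<lceil>(n + 1) / 2\<rceil>\<close> of the range.\<close>

fun level_shape :: "ltype \<Rightarrow> shape" where
  "level_shape L1a = \<lparr>coeff_before = 0, coeff_at = 1, coeff_after = 1, deficit = 1,
     quad = 1, lin = 1, neglin = 0, const = 0, lowest = 3, shift = 1, gap = 4\<rparr>"
| "level_shape L1b = \<lparr>coeff_before = 0, coeff_at = 1, coeff_after = 2, deficit = 1,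
     quad = 2, lin = 0, neglin = 0, const = 2, lowest = 2, shift = 1, gap = 4\<rparr>"
| "level_shape L2a = \<lparr>coeff_before = 1, coeff_at = 1, coeff_after = 1, deficit = 2,
     quad = 1, lin = 1, neglin = 0, const = 0, lowest = 4, shift = 2, gap = 4\<rparr>"
| "level_shape L2b = \<lparr>coeff_before = 2, coeff_at = 1, coeff_after = 2, deficit = 2,
     quad = 2, lin = 0, neglin = 0, const = 2, lowest = 4, shift = 2, gap = 4\<rparr>"
| "level_shape L2c = \<lparr>coeff_before = 2, coeff_at = 1, coeff_after = 4, deficit = 2,
     quad = 4, lin = 0, neglin = 6, const = 10, lowest = 3, shift = 2, gap = 4\<rparr>"
| "level_shape L2d = \<lparr>coeff_before = 3, coeff_at = 2, coeff_after = 4, deficit = 2,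
     quad = 4, lin = 0, neglin = 2, const = 8, lowest = 3, shift = 2, gap = 4\<rparr>"
| "level_shape L2e = \<lparr>coeff_before = 3, coeff_at = 2, coeff_after = 5, deficit = 2,
     quad = 5, lin = 0, neglin = 5, const = 12, lowest = 3, shift = 2, gap = 4\<rparr>"

lemma shape_rhs_level:
  "shape_rhs (level_shape L1a) m = 1/2 * real m * (real m + 1)"
  "shape_rhs (level_shape L1b) m = (real m)\<^sup>2 + 1"
  "shape_rhs (level_shape L2a) m = 1/2 * real m * (real m + 1)"
  "shape_rhs (level_shape L2b) m = (real m)\<^sup>2 + 1"
  "shape_rhs (level_shape L2c) m = real m * (2 * real m - 3) + 5"
  "shape_rhs (level_shape L2d) m = real m * (2 * real m - 1) + 4"
  "shape_rhs (level_shape L2e) m = 5/2 * real m * (real m - 1) + 6"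
  by (simp_all add: shape_rhs_def power2_eq_square field_simps)

lemma level_ineqs_shape: "level_ineqs t n m = shape_ineqs (level_shape t) n m"
  by (cases t; hypsubst; unfold level_ineqs.simps level1_ineqs_def level2_ineqs_def
      shape_ineqs_def shape_ineq_def shape_rhs_level; simp)

lemma ceiling_half: "\<lceil>real n / 2\<rceil> = int ((n + 1) div 2)"
proof (cases "even n")
  case True
  then show ?thesis by (auto elim!: evenE)
next
  case False
  then obtain k where "n = 2 * k + 1" by (elim oddE)
  then show ?thesis by (intro ceiling_unique) auto
qed

lemma m_range_shape: "m_range t n = shape_range (level_shape t) n"
proof -
  have c: "\<lceil>(real n + 1) / 2\<rceil> = int ((n + 2) div 2)"
    using ceiling_half[of "n + 1"] by (simp add: add.commute)
  show ?thesis
    by (cases t) (auto simp: m_range_def shape_range_def m_max_def ceiling_half c)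
qed

lemma level_family_shape: "level_family t n v = shape_family (level_shape t) n"
  by (simp add: level_family_def shape_family_def level_ineqs_shape m_range_shape)

text \<open>A set of size \<open>m\<close> above \<open>m\<close> exists only for \<open>m \<le> n div 2\<close>, so the range of \<open>m\<close> fits the pattern
  of the other levels.\<close>

lemma L0_shape: "L0 n v = shape_family level0_shape n"
proof -
  have ineq: "shape_ineq level0_shape m J = Ineq (\<lambda>k. of_bool (k \<in> J)) Ge (1/2 * real m * (real m + 1))"
    for m J by (simp add: shape_ineq_def shape_rhs_def level0_shape_def distrib_left)
  have half: "m \<le> n div 2" if "J \<subseteq> {m+1..n}" "card J = m" for m J
    using card_mono[OF _ that(1)] that(2) by simp
  have range: "shape_range level0_shape n = {m. 2 \<le> m \<and> m \<le> n div 2}"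
    by (auto simp: shape_range_def level0_shape_def)
  have ineqs: "shape_ineqs level0_shape n m = {shape_ineq level0_shape m J | J. J \<subseteq> {m+1..n} \<and> card J = m}"
    for m by (simp add: shape_ineqs_def level0_shape_def)
  have "L0 n v = {shape_ineq level0_shape m J | m J. m \<in> {2..n} \<and> J \<subseteq> {m+1..n} \<and> card J = m}"
    unfolding ineq L0_def ..
  moreover have iff: "m \<in> {2..n} \<and> J \<subseteq> {m+1..n} \<and> card J = m \<longleftrightarrow>
      m \<in> {m. 2 \<le> m \<and> m \<le> n div 2} \<and> J \<subseteq> {m+1..n} \<and> card J = m" for m J
    using half[of J m] by auto
  ultimately have "L0 n v = {shape_ineq level0_shape m J | m J.
      m \<in> {m. 2 \<le> m \<and> m \<le> n div 2} \<and> J \<subseteq> {m+1..n} \<and> card J = m}"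
    by (simp only: iff)
  also have "\<dots> = shape_family level0_shape n"
    unfolding shape_family_def range ineqs by blast
  finally show ?thesis .
qed

lemma lowest_level_shape: "2 \<le> lowest (level_shape t)"
  by (cases t) auto

section \<open>The two-term inequalities\<close>

definition two_term :: "real \<Rightarrow> nat \<Rightarrow> real \<Rightarrow> nat \<Rightarrow> sense \<Rightarrow> real \<Rightarrow> ineq" where
  "two_term a i b j sns r = Ineq (\<lambda>k. a * of_bool (k = i) + b * of_bool (k = j)) sns r"

text \<open>The three variables \<open>a\<close>, \<open>b\<close>, \<open>r\<close> hold the coefficients and the right-hand side, \<open>i\<close> the fixed
  index; the index \<open>j\<close> runs, with \<open>i\<close> itself left out, from \<open>lo\<close> to \<open>hi\<close>.\<close>

definition scan_step :: "sense \<Rightarrow> com" where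
  "scan_step sns = (let e = RAdd (RMul (RVar ''a'') (RElem ''x'' (IVar ''i'')))
       (RMul (RVar ''b'') (RElem ''x'' (IVar ''j''))) in
     If_then (Conj (Neg (ILess (INum 0) (IVar ''out'')))
             (Conj (Neg (ILess (IVar ''j'') (IVar ''lo'')))
             (Conj (Neg (ILess (IVar ''hi'') (IVar ''j'')))
             (Conj (Neg (Conj (Neg (ILess (IVar ''i'') (IVar ''j'')))
                              (Neg (ILess (IVar ''j'') (IVar ''i'')))))
               (case sns of Ge \<Rightarrow> RLess e (RVar ''r'') | Le \<Rightarrow> RLess (RVar ''r'') e)))))
       (seqs [ISet ''out'' (INum (case sns of Ge \<Rightarrow> 1 | Le \<Rightarrow> 2)), RSet ''out'' (RVar ''r''),
          RStore ''out'' (IVar ''i'') (RVar ''a''), RStore ''out'' (IVar ''j'') (RVar ''b'')]))"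

definition scan :: "sense \<Rightarrow> com" where
  "scan sns = for_to ''j'' ''n'' (scan_step sns)"

definition scan_family :: "sense \<Rightarrow> state \<Rightarrow> ineq set" where
  "scan_family sns s = {two_term (rvar s ''a'') (ivar s ''i'') (rvar s ''b'') j sns (rvar s ''r'') | j.
     j \<in> {ivar s ''lo''..ivar s ''hi''} \<and> j \<noteq> ivar s ''i''}"

lemma violated_two_term:
  assumes "i \<in> {1..n}" "j \<in> {1..n}"
  shows "violated n (two_term a i b j sns r) x \<longleftrightarrow>
    (case sns of Ge \<Rightarrow> a * x i + b * x j < r | Le \<Rightarrow> r < a * x i + b * x j)"
proof -
  have single: "(\<Sum>k = 1..n. of_bool (k = i) * x k) = x i" if "i \<in> {1..n}" for i
    using that by (simp add: of_bool_def if_distrib[of "\<lambda>c. c * _"] cong: if_cong)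
  have "lhs n (two_term a i b j sns r) x =
      a * (\<Sum>k = 1..n. of_bool (k = i) * x k) + b * (\<Sum>k = 1..n. of_bool (k = j) * x k)"
    by (simp add: lhs_def two_term_def distrib_right sum.distrib sum_distrib_left mult.assoc
        del: sum_of_bool_mult_eq)
  also have "\<dots> = a * x i + b * x j"
    by (simp only: single assms)
  finally have "lhs n (two_term a i b j sns r) x = a * x i + b * x j" .
  moreover have "sense_of (two_term a i b j sns r) = sns" "rhs (two_term a i b j sns r) = r"
    by (simp_all add: two_term_def)
  ultimately show ?thesis
    unfolding violated_def by (cases sns) simp_all
qed

lemma scan_correct:
  assumes n: "ivar s ''n'' = n" and x: "\<And>i. i \<in> {1..n} \<Longrightarrow> rarr s ''x'' i = x i"
    and out: "ivar s ''out'' = 0" "rarr s ''out'' = (\<lambda>_. 0)"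
    and i: "ivar s ''i'' \<in> {1..n}" and range: "1 \<le> ivar s ''lo''" "ivar s ''hi'' \<le> n"
  shows "runs_within (scan sns) s (100 * Suc n)
    (\<lambda>t. correct_answer n x (scan_family sns s) (result n ''out'' t))"
proof -
  let ?i = "ivar s ''i''"
  let ?I = "\<lambda>j. two_term (rvar s ''a'') ?i (rvar s ''b'') j sns (rvar s ''r'')"
  define F where "F = (\<lambda>k. {?I j | j. j \<in> {ivar s ''lo''..ivar s ''hi''} \<and> j \<noteq> ?i \<and> j \<le> k})"
  define Inv where "Inv = (\<lambda>k t. correct_answer n x (F k) (result n ''out'' t) \<and>
    (ivar t ''out'' = 0 \<longrightarrow> rarr t ''out'' = (\<lambda>_. 0)))"
  have "runs_within (scan sns) s ((10 + 80) * Suc n) (Inv n)"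
    unfolding scan_def
  proof (rule runs_within_for_to)
    have "F 0 = {}" using range by (auto simp: F_def)
    then show "Inv 0 (s\<lparr>ivar := (ivar s)(''j'' := 0)\<rparr>)"
      using out by (simp add: Inv_def correct_answer_def result_def)
  next
    fix k t assume k: "k < n" and Inv: "Inv k t"
      and ag: "agree (insert ''j'' (written (scan_step sns))) s t"
    let ?t = "t\<lparr>ivar := (ivar t)(''j'' := Suc k)\<rparr>"
    have frame: "ivar t ''i'' = ?i" "ivar t ''lo'' = ivar s ''lo''" "ivar t ''hi'' = ivar s ''hi''"
      "rvar t ''a'' = rvar s ''a''" "rvar t ''b'' = rvar s ''b''" "rvar t ''r'' = rvar s ''r''"
      "rarr t ''x'' = rarr s ''x''"
      using ag by (simp_all add: agree_def scan_step_def Let_def)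
    have xs: "rarr s ''x'' (Suc k) = x (Suc k)" "rarr s ''x'' ?i = x ?i"
      using k i x by auto
    have res: "result n ''out'' ?t = result n ''out'' t"
      by (intro result_agree[of "{''j''}"] agree_set_ivar) auto
    let ?new = "Suc k \<in> {ivar s ''lo''..ivar s ''hi''} \<and> Suc k \<noteq> ?i"
    have F_Suc: "F (Suc k) = F k \<union> (if ?new then {?I (Suc k)} else {})"
      by (auto simp: F_def le_Suc_eq)
    have viol: "violated n (?I (Suc k)) x \<longleftrightarrow>
        (case sns of Ge \<Rightarrow> rvar s ''a'' * x ?i + rvar s ''b'' * x (Suc k) < rvar s ''r''
         | Le \<Rightarrow> rvar s ''r'' < rvar s ''a'' * x ?i + rvar s ''b'' * x (Suc k))"
      using i k by (intro violated_two_term) auto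
    let ?u = "eff (scan_step sns) ?t"
    have "Inv (Suc k) ?u"
    proof (cases "ivar t ''out'' = 0 \<and> ?new \<and> violated n (?I (Suc k)) x")
      case True
      have u: "ivar ?u ''out'' = (case sns of Ge \<Rightarrow> 1 | Le \<Rightarrow> 2)" "rvar ?u ''out'' = rvar s ''r''"
        "rarr ?u ''out'' = (\<lambda>_. 0)(?i := rvar s ''a'', Suc k := rvar s ''b'')"
        using True Inv viol frame xs
        by (auto simp: scan_step_def Let_def Inv_def split: sense.splits)
      have "result n ''out'' ?u = Some (?I (Suc k))"
        using True i k by (intro result_SomeI) (auto simp: u two_term_def)
      moreover have "ivar ?u ''out'' \<noteq> 0" using u(1) by (simp split: sense.splits)
      ultimately show ?thesis
        using True by (auto simp: Inv_def correct_answer_def F_Suc)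
    next
      case False
      then have "?u = ?t"
        using viol frame xs by (auto simp: scan_step_def Let_def split: sense.splits)
      moreover have "correct_answer n x (F (Suc k)) (result n ''out'' t)"
      proof (cases "ivar t ''out'' = 0")
        case True
        then have "result n ''out'' t = None" by (simp add: result_def)
        then show ?thesis using Inv False True by (auto simp: Inv_def correct_answer_def F_Suc)
      next
        case False
        then obtain J where "result n ''out'' t = Some J" by (simp add: result_def)
        then show ?thesis using Inv by (auto simp: Inv_def correct_answer_def F_Suc)
      qed
      ultimately show ?thesis using Inv res by (simp add: Inv_def)
    qed
    then show "runs_within (scan_step sns) ?t 80 (Inv (Suc k))"
      by (intro runs_within_straight) (auto simp: scan_step_def Let_def split: sense.splits)
  qed (auto simp: n scan_step_def Let_def)
  moreover have "F n = scan_family sns s"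
    using range by (auto simp: F_def scan_family_def)
  ultimately show ?thesis
    by (elim runs_within_mono) (simp_all add: Inv_def)
qed

lemma time_O_I:
  assumes "\<And>n. N \<le> n \<Longrightarrow> real (T n) \<le> K * g n"
  shows "time_O T g"
  unfolding time_O_def
proof (rule bigoI[where c = "\<bar>K\<bar>"])
  have "norm (real (T n)) \<le> \<bar>K\<bar> * norm (g n)" if "N \<le> n" for n
  proof -
    have "real (T n) \<le> \<bar>K * g n\<bar>" using assms[OF that] by linarith
    then show ?thesis by (simp add: abs_mult)
  qed
  then show "\<forall>\<^sub>F n in sequentially. norm (real (T n)) \<le> \<bar>K\<bar> * norm (g n)"
    by (auto simp: eventually_sequentially)
qed

lemma time_O_linear: "time_O (\<lambda>n. K * Suc n) (\<lambda>n. real n)"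
proof (rule time_O_I[where N = 1 and K = "2 * real K"])
  fix n :: nat assume "1 \<le> n"
  then have "K * Suc n \<le> 2 * K * n" by simp
  then show "real (K * Suc n) \<le> 2 * real K * real n" by (metis of_nat_le_iff of_nat_mult of_nat_numeral)
qed

lemma init_simps:
  "ivar (init n v x) = (\<lambda>_. 0)(''n'' := n)" "iarr (init n v x) = (\<lambda>_ _. 0)"
  "rvar (init n v x) = (\<lambda>_. 0)"
  "rarr (init n v x) = (\<lambda>_ _. 0)(''v'' := (\<lambda>i. if i \<in> {1..n} then v i else 0),
                      ''x'' := (\<lambda>i. if i \<in> {1..n} then x i else 0))"
  by (simp_all add: init_def)

text \<open>The program \<open>c\<close> sets up the parameters of the scan.  They may depend on the point \<open>x\<close>, in
  which case the scanned inequalities can be a proper part of \<open>F\<close>.\<close>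

lemma separable_by_scan:
  assumes prepare: "\<And>n v x. general6 n v \<Longrightarrow> runs_within c (init n v x) (K * Suc n)
      (\<lambda>s. ivar s ''i'' \<in> {1..n} \<and> 1 \<le> ivar s ''lo'' \<and> ivar s ''hi'' \<le> n \<and>
        (\<forall>r. correct_answer n x (scan_family sns s) r \<longrightarrow> correct_answer n x (F n v) r))"
    and unwritten: "written c \<inter> {''n'', ''x'', ''out''} = {}"
  shows "\<exists>c T. time_O T (\<lambda>n. real n) \<and> separates general6 F c T"
proof (intro exI conjI)
  show "time_O (\<lambda>n. (K + 100) * Suc n) (\<lambda>n. real n)" by (rule time_O_linear)
  show "separates general6 F (Seq c (scan sns)) (\<lambda>n. (K + 100) * Suc n)"
    unfolding separates_def
  proof (intro allI impI)
    fix n v x assume "general6 n v"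
    from prepare[OF this]
    show "runs_within (Seq c (scan sns)) (init n v x) ((K + 100) * Suc n)
      (\<lambda>s. correct_answer n x (F n v) (result n ''out'' s))"
    proof (rule runs_within_Seq)
      fix s assume s: "ivar s ''i'' \<in> {1..n} \<and> 1 \<le> ivar s ''lo'' \<and> ivar s ''hi'' \<le> n \<and>
        (\<forall>r. correct_answer n x (scan_family sns s) r \<longrightarrow> correct_answer n x (F n v) r)"
        "agree (written c) (init n v x) s"
      have "ivar s ''n'' = n" "rarr s ''x'' = (\<lambda>i. if i \<in> {1..n} then x i else 0)"
        "ivar s ''out'' = 0" "rarr s ''out'' = (\<lambda>_. 0)"
        using s(2) unwritten by (auto simp: agree_def init_simps)
      then have "runs_within (scan sns) s (100 * Suc n)
          (\<lambda>t. correct_answer n x (scan_family sns s) (result n ''out'' t))"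
        using s(1) by (intro scan_correct) auto
      then show "runs_within (scan sns) s (100 * Suc n)
          (\<lambda>t. correct_answer n x (F n v) (result n ''out'' t))"
        using s(1) by (elim runs_within_mono) auto
    qed (simp add: algebra_simps)
  qed
qed

text \<open>The case in which the fixed index is given in advance and lies outside the scanned range.\<close>

lemma separable_by_straight_scan:
  assumes "straight c" "max_cost c \<le> K" "written c \<inter> {''n'', ''x'', ''out''} = {}"
    and state: "\<And>n v x s. general6 n v \<Longrightarrow> s = eff c (init n v x) \<Longrightarrow>
      ivar s ''i'' = i n \<and> ivar s ''lo'' = lo n \<and> ivar s ''hi'' = hi n \<and>
      rvar s ''a'' = a n v \<and> rvar s ''b'' = b n v \<and> rvar s ''r'' = r n v"
    and range: "\<And>n. 6 \<le> n \<Longrightarrow> i n \<in> {1..n} - {lo n..hi n} \<and> 1 \<le> lo n \<and> hi n \<le> n"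
    and F: "\<And>n v. F n v = {two_term (a n v) (i n) (b n v) j sns (r n v) | j. j \<in> {lo n..hi n}}"
  shows "\<exists>c T. time_O T (\<lambda>n. real n) \<and> separates general6 F c T"
proof (rule separable_by_scan[where sns = sns, OF _ assms(3)])
  fix n v x assume n: "general6 n v"
  let ?s = "eff c (init n v x)"
  have range: "i n \<in> {1..n}" "i n \<notin> {lo n..hi n}" "1 \<le> lo n" "hi n \<le> n"
    using range[of n] n by (auto simp: general6_def)
  have iff: "j \<in> {lo n..hi n} \<and> j \<noteq> i n \<longleftrightarrow> j \<in> {lo n..hi n}" for j
    using range(2) by blast
  have "scan_family sns ?s = F n v"
    unfolding scan_family_def F by (simp only: state[OF n refl] iff)
  then show "runs_within c (init n v x) (K * Suc n)
      (\<lambda>s. ivar s ''i'' \<in> {1..n} \<and> 1 \<le> ivar s ''lo'' \<and> ivar s ''hi'' \<le> n \<and>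
        (\<forall>r. correct_answer n x (scan_family sns s) r \<longrightarrow> correct_answer n x (F n v) r))"
    using assms(1,2) range state[OF n refl, of x] by (intro runs_within_straight) auto
qed

abbreviation v_at :: "iexp \<Rightarrow> rexp" where
  "v_at e \<equiv> RElem ''v'' e"

definition prepare_scan :: "iexp \<Rightarrow> iexp \<Rightarrow> iexp \<Rightarrow> rexp \<Rightarrow> rexp \<Rightarrow> rexp \<Rightarrow> com" where
  "prepare_scan i lo hi a b r = seqs [ISet ''i'' i, ISet ''lo'' lo, ISet ''hi'' hi,
     RSet ''a'' a, RSet ''b'' b, RSet ''r'' r]"

lemma T2_linear: "\<exists>c T. time_O T (\<lambda>n. real n) \<and> separates general6 T2 c T"
proof (rule separable_by_straight_scan[where K = 100 and sns = Ge
      and i = "\<lambda>n. 1" and lo = "\<lambda>n. 2" and hi = "\<lambda>n. 2"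
      and a = "\<lambda>n v. v 3 - v 1" and b = "\<lambda>n v. v 3 - v 2" and r = "\<lambda>n v. (v 3)\<^sup>2 - v 1 * v 2"])
  let ?c = "prepare_scan (INum 1) (INum 2) (INum 2)
    (RSub (v_at (INum 3)) (v_at (INum 1))) (RSub (v_at (INum 3)) (v_at (INum 2)))
    (RSub (RMul (v_at (INum 3)) (v_at (INum 3))) (RMul (v_at (INum 1)) (v_at (INum 2))))"
  show "straight ?c" "max_cost ?c \<le> 100" "written ?c \<inter> {''n'', ''x'', ''out''} = {}"
    by (auto simp: prepare_scan_def)
  fix n v x s assume "general6 n v" "s = eff ?c (init n v x)"
  then show "ivar s ''i'' = 1 \<and> ivar s ''lo'' = 2 \<and> ivar s ''hi'' = 2 \<and>
      rvar s ''a'' = v 3 - v 1 \<and> rvar s ''b'' = v 3 - v 2 \<and>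
      rvar s ''r'' = (v 3)\<^sup>2 - v 1 * v 2"
    by (simp add: prepare_scan_def init_simps general6_def power2_eq_square)
qed (auto simp: T2_def two_term_def)

lemma T3_linear: "\<exists>c T. time_O T (\<lambda>n. real n) \<and> separates general6 T3 c T"
proof (rule separable_by_straight_scan[where K = 100 and sns = Ge
      and i = "\<lambda>n. 2" and lo = "\<lambda>n. 3" and hi = "\<lambda>n. n"
      and a = "\<lambda>n v. v 2 - v 1" and b = "\<lambda>n v. v 3 - v 1" and r = "\<lambda>n v. v 2 * v 3 - (v 1)\<^sup>2"])
  let ?c = "prepare_scan (INum 2) (INum 3) (IVar ''n'')
    (RSub (v_at (INum 2)) (v_at (INum 1))) (RSub (v_at (INum 3)) (v_at (INum 1)))
    (RSub (RMul (v_at (INum 2)) (v_at (INum 3))) (RMul (v_at (INum 1)) (v_at (INum 1))))"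
  show "straight ?c" "max_cost ?c \<le> 100" "written ?c \<inter> {''n'', ''x'', ''out''} = {}"
    by (auto simp: prepare_scan_def)
  fix n v x s assume "general6 n v" "s = eff ?c (init n v x)"
  then show "ivar s ''i'' = 2 \<and> ivar s ''lo'' = 3 \<and> ivar s ''hi'' = n \<and>
      rvar s ''a'' = v 2 - v 1 \<and> rvar s ''b'' = v 3 - v 1 \<and>
      rvar s ''r'' = v 2 * v 3 - (v 1)\<^sup>2"
    by (simp add: prepare_scan_def init_simps general6_def power2_eq_square)
qed (auto simp: T3_def two_term_def)

lemma T4_linear: "\<exists>c T. time_O T (\<lambda>n. real n) \<and> separates general6 T4 c T"
proof (rule separable_by_straight_scan[where K = 100 and sns = Le
      and i = "\<lambda>n. n - 1" and lo = "\<lambda>n. n" and hi = "\<lambda>n. n"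
      and a = "\<lambda>n v. v (n - 1) - v (n - 2)" and b = "\<lambda>n v. v n - v (n - 2)" and r = "\<lambda>n v. v n * v (n - 1) - (v (n - 2))\<^sup>2"])
  let ?n = "IVar ''n''" let ?n1 = "ISub ?n (INum 1)" and ?n2 = "ISub ?n (INum 2)"
  let ?c = "prepare_scan ?n1 ?n ?n (RSub (v_at ?n1) (v_at ?n2)) (RSub (v_at ?n) (v_at ?n2))
    (RSub (RMul (v_at ?n) (v_at ?n1)) (RMul (v_at ?n2) (v_at ?n2)))"
  show "straight ?c" "max_cost ?c \<le> 100" "written ?c \<inter> {''n'', ''x'', ''out''} = {}"
    by (auto simp: prepare_scan_def)
  fix n v x s assume n: "general6 n v" and s: "s = eff ?c (init n v x)"
  have "Suc 0 \<le> n - Suc 0" "Suc 0 \<le> n - 2" using n by (auto simp: general6_def)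
  with n s show "ivar s ''i'' = n - 1 \<and> ivar s ''lo'' = n \<and> ivar s ''hi'' = n \<and>
      rvar s ''a'' = v (n - 1) - v (n - 2) \<and> rvar s ''b'' = v n - v (n - 2) \<and>
      rvar s ''r'' = v n * v (n - 1) - (v (n - 2))\<^sup>2"
    by (simp add: prepare_scan_def init_simps general6_def power2_eq_square)
qed (auto simp: T4_def two_term_def)

lemma T5_linear: "\<exists>c T. time_O T (\<lambda>n. real n) \<and> separates general6 T5 c T"
proof (rule separable_by_straight_scan[where K = 100 and sns = Le
      and i = "\<lambda>n. n - 1" and lo = "\<lambda>n. 1" and hi = "\<lambda>n. n - 2"
      and a = "\<lambda>n v. v n - v (n - 1)" and b = "\<lambda>n v. v n - v (n - 2)" and r = "\<lambda>n v. (v n)\<^sup>2 - v (n - 1) * v (n - 2)"])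
  let ?n = "IVar ''n''" let ?n1 = "ISub ?n (INum 1)" and ?n2 = "ISub ?n (INum 2)"
  let ?c = "prepare_scan ?n1 (INum 1) ?n2 (RSub (v_at ?n) (v_at ?n1)) (RSub (v_at ?n) (v_at ?n2))
    (RSub (RMul (v_at ?n) (v_at ?n)) (RMul (v_at ?n1) (v_at ?n2)))"
  show "straight ?c" "max_cost ?c \<le> 100" "written ?c \<inter> {''n'', ''x'', ''out''} = {}"
    by (auto simp: prepare_scan_def)
  fix n v x s assume n: "general6 n v" and s: "s = eff ?c (init n v x)"
  have "Suc 0 \<le> n - Suc 0" "Suc 0 \<le> n - 2" using n by (auto simp: general6_def)
  with n s show "ivar s ''i'' = n - 1 \<and> ivar s ''lo'' = 1 \<and> ivar s ''hi'' = n - 2 \<and>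
      rvar s ''a'' = v n - v (n - 1) \<and> rvar s ''b'' = v n - v (n - 2) \<and>
      rvar s ''r'' = (v n)\<^sup>2 - v (n - 1) * v (n - 2)"
    by (simp add: prepare_scan_def init_simps general6_def power2_eq_square)
qed (auto simp: T5_def two_term_def add.commute)

definition argmin_step :: com where
  "argmin_step = If_then (Conj (ILess (INum 3) (IVar ''j''))
       (RLess (RElem ''x'' (IVar ''j'')) (RElem ''x'' (IVar ''i''))))
     (ISet ''i'' (IVar ''j''))"

text \<open>In a violated pair, one of the two indices can be replaced by \<open>i\<close>.\<close>

lemma T1_by_smallest:
  assumes i: "i \<in> {3..n}" and least: "\<And>l. l \<in> {3..n} \<Longrightarrow> x i \<le> x l"
    and r: "correct_answer n x {two_term 1 i 1 j Ge (v 1 + v 2) | j. j \<in> {3..n} \<and> j \<noteq> i} r"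
  shows "correct_answer n x (T1 n v) r"
proof -
  have T1: "T1 n v = {two_term 1 k 1 j Ge (v 1 + v 2) | k j. k \<in> {3..n} \<and> j \<in> {3..n} \<and> k \<noteq> j}"
    by (simp add: T1_def two_term_def)
  have "\<exists>j\<in>{3..n}. j \<noteq> i \<and> violated n (two_term 1 i 1 j Ge (v 1 + v 2)) x"
    if kj: "k \<in> {3..n}" "j \<in> {3..n}" "k \<noteq> j" and viol: "violated n (two_term 1 k 1 j Ge (v 1 + v 2)) x" for k j
  proof -
    have viol_iff: "violated n (two_term 1 k 1 j Ge (v 1 + v 2)) x \<longleftrightarrow> x k + x j < v 1 + v 2"
      if "k \<in> {3..n}" "j \<in> {3..n}" for k j
      using that by (subst violated_two_term) auto
    have kj_less: "x k + x j < v 1 + v 2" using viol viol_iff kj by blast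
    show ?thesis
    proof (cases "j = i")
      case True
      then have "violated n (two_term 1 i 1 k Ge (v 1 + v 2)) x"
        using kj_less viol_iff kj by (simp add: add.commute)
      then show ?thesis using kj True by blast
    next
      case False
      have "x i \<le> x k" using least kj by blast
      then have "violated n (two_term 1 i 1 j Ge (v 1 + v 2)) x"
        using kj_less viol_iff[OF i kj(2)] by linarith
      then show ?thesis using kj False by blast
    qed
  qed
  note exists_violated = this
  define S where "S = {two_term 1 i 1 j Ge (v 1 + v 2) | j. j \<in> {3..n} \<and> j \<noteq> i}"
  have sub: "S \<subseteq> T1 n v" unfolding S_def T1 using i by blast
  have "\<exists>J\<in>S. violated n J x" if "J \<in> T1 n v" "violated n J x" for J
    using that exists_violated unfolding S_def T1 by blast
  with sub r[folded S_def] show ?thesis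
    unfolding correct_answer_def by (cases r) auto
qed

lemma T1_linear: "\<exists>c T. time_O T (\<lambda>n. real n) \<and> separates general6 T1 c T"
proof (rule separable_by_scan[where sns = Ge and K = 200])
  let ?prepare = "prepare_scan (INum 3) (INum 3) (IVar ''n'') (RNat (INum 1)) (RNat (INum 1))
    (RAdd (v_at (INum 1)) (v_at (INum 2)))"
  let ?c = "Seq ?prepare (for_to ''j'' ''n'' argmin_step)"
  show "written ?c \<inter> {''n'', ''x'', ''out''} = {}"
    by (auto simp: prepare_scan_def argmin_step_def)
  fix n v x assume n: "general6 n v"
  let ?s = "eff ?prepare (init n v x)"
  define I where "I = (\<lambda>k (t :: state). ivar t ''i'' \<in> {3..max 3 k} \<and> (\<forall>l\<in>{3..k}. x (ivar t ''i'') \<le> x l))"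
  have "runs_within (for_to ''j'' ''n'' argmin_step) ?s ((10 + 40) * Suc n) (I n)"
  proof (rule runs_within_for_to)
    show "I 0 (?s\<lparr>ivar := (ivar ?s)(''j'' := 0)\<rparr>)"
      by (simp add: I_def prepare_scan_def)
  next
    fix k t assume k: "k < n" and t: "I k t" "agree (insert ''j'' (written argmin_step)) ?s t"
    let ?t = "t\<lparr>ivar := (ivar t)(''j'' := Suc k)\<rparr>"
    have "rarr t ''x'' = (\<lambda>i. if i \<in> {1..n} then x i else 0)"
      using t(2) by (auto simp: agree_def argmin_step_def prepare_scan_def init_simps)
    moreover have "ivar t ''i'' \<in> {1..n}" using t(1) k n by (auto simp: I_def general6_def)
    ultimately have eff: "eff argmin_step ?t = (if 3 < Suc k \<and> x (Suc k) < x (ivar t ''i'')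
        then ?t\<lparr>ivar := (ivar ?t)(''i'' := Suc k)\<rparr> else ?t)"
      using k by (simp add: argmin_step_def)
    have "I (Suc k) (eff argmin_step ?t)"
    proof (cases "3 < Suc k")
      case True
      then have "{3..Suc k} = insert (Suc k) {3..k}" "max 3 k = k" by auto
      then show ?thesis using t(1) unfolding eff I_def by force
    next
      case False
      then have "ivar t ''i'' = 3" "{3..Suc k} \<subseteq> {3}" using t(1) by (auto simp: I_def)
      then show ?thesis using False unfolding eff I_def by auto
    qed
    then show "runs_within argmin_step ?t 40 (I (Suc k))"
      by (intro runs_within_straight) (auto simp: argmin_step_def)
  qed (auto simp: argmin_step_def prepare_scan_def init_simps)
  then have argmin: "runs_within (for_to ''j'' ''n'' argmin_step) ?s (50 * Suc n)
      (\<lambda>t. I n t \<and> agree {''i'', ''j''} ?s t)"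
    by (rule runs_within_conj_agree) (auto simp: argmin_step_def insert_commute)
  show "runs_within ?c (init n v x) (200 * Suc n)
      (\<lambda>s. ivar s ''i'' \<in> {1..n} \<and> 1 \<le> ivar s ''lo'' \<and> ivar s ''hi'' \<le> n \<and>
        (\<forall>r. correct_answer n x (scan_family Ge s) r \<longrightarrow> correct_answer n x (T1 n v) r))"
  proof (rule runs_within_straight_Seq)
    show "runs_within (for_to ''j'' ''n'' argmin_step) ?s (50 * Suc n)
      (\<lambda>s. ivar s ''i'' \<in> {1..n} \<and> 1 \<le> ivar s ''lo'' \<and> ivar s ''hi'' \<le> n \<and>
        (\<forall>r. correct_answer n x (scan_family Ge s) r \<longrightarrow> correct_answer n x (T1 n v) r))"
    proof (rule runs_within_mono[OF argmin order_refl])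
      fix s assume s: "I n s \<and> agree {''i'', ''j''} ?s s"
      have i: "ivar s ''i'' \<in> {3..n}" "\<And>l. l \<in> {3..n} \<Longrightarrow> x (ivar s ''i'') \<le> x l"
        using s n by (auto simp: I_def general6_def)
      have "ivar s ''lo'' = 3" "ivar s ''hi'' = n" "rvar s ''a'' = 1" "rvar s ''b'' = 1"
        "rvar s ''r'' = v 1 + v 2"
        using s n by (auto simp: agree_def prepare_scan_def init_simps general6_def)
      then show "ivar s ''i'' \<in> {1..n} \<and> 1 \<le> ivar s ''lo'' \<and> ivar s ''hi'' \<le> n \<and>
        (\<forall>r. correct_answer n x (scan_family Ge s) r \<longrightarrow> correct_answer n x (T1 n v) r)"
        using i T1_by_smallest[where x = x and i = "ivar s ''i''", OF i] by (auto simp: scan_family_def)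
    qed
  qed (auto simp: prepare_scan_def)
qed

section \<open>Running times\<close>

abbreviation loglen :: "nat \<Rightarrow> nat" where
  "loglen n \<equiv> floorlog 2 n"

lemma le_power_loglen: "n \<le> 2 ^ loglen n"
  using floorlog_bounds[of n 2] by (cases "n = 0") auto

text \<open>The bound \<open>3 \<le> n\<close> makes \<open>ln n \<ge> 1\<close>, so that additive constants are absorbed; the constant
  comes from \<open>ln 2 \<ge> 1/2\<close>.\<close>

lemma Suc_mult_Suc_loglen:
  assumes "3 \<le> n"
  shows "real (Suc n * Suc (loglen n)) \<le> 8 * (real n * ln (real n))"
proof -
  have ln: "1 \<le> ln (real n)"
    using assms exp_le by (simp add: ln_ge_iff)
  have "1 \<le> ln (2 ^ 2 :: real)"
    using exp_le by (subst ln_ge_iff) auto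
  then have ln2: "1 \<le> 2 * ln (2 :: real)" by (subst (asm) ln_realpow) auto
  have "real (loglen n) \<le> log 2 (real n) + 1"
    using assms by (simp add: floorlog_def)
  also have "log 2 (real n) = ln (real n) / ln 2" by (simp add: log_def)
  also have "ln (real n) / ln 2 \<le> 2 * ln (real n)"
    using ln mult_left_mono[OF ln2, of "ln (real n)"]
    by (simp add: field_simps)
  finally have "real (Suc (loglen n)) \<le> 4 * ln (real n)" using ln by simp
  moreover have "real (Suc n) \<le> 2 * real n" using assms by simp
  ultimately have "real (Suc n) * real (Suc (loglen n)) \<le> (2 * real n) * (4 * ln (real n))"
    by (intro mult_mono) auto
  also have "\<dots> = 8 * (real n * ln (real n))" by simp
  finally show ?thesis by (simp only: of_nat_mult)
qed

lemma time_O_n_ln_n: "time_O (\<lambda>n. K * (Suc n * Suc (loglen n))) (\<lambda>n. real n * ln (real n))"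
proof (rule time_O_I[where N = 3 and K = "8 * real K"])
  fix n :: nat assume "3 \<le> n"
  define t where "t = Suc n * Suc (loglen n)"
  have "real K * real t \<le> real K * (8 * (real n * ln (real n)))"
    unfolding t_def using \<open>3 \<le> n\<close> by (intro mult_left_mono Suc_mult_Suc_loglen) auto
  then show "real (K * (Suc n * Suc (loglen n))) \<le> 8 * real K * (real n * ln (real n))"
    unfolding t_def[symmetric] by simp
qed

lemma time_O_quadratic:
  "time_O (\<lambda>n. K * (Suc n * Suc (loglen n)) + Suc (M * (Suc n * Suc n))) (\<lambda>n. (real n)\<^sup>2)"
proof (rule time_O_I[where N = 3 and K = "8 * real K + 4 * real M + 1"])
  fix n :: nat assume n: "3 \<le> n"
  have "real n * ln (real n) \<le> (real n)\<^sup>2"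
    using n ln_bound[of "real n"] by (simp add: power2_eq_square mult_left_mono)
  moreover define t where "t = Suc n * Suc (loglen n)"
  ultimately have "real t \<le> 8 * (real n)\<^sup>2"
    using Suc_mult_Suc_loglen[OF n] by linarith
  then have "real K * real t \<le> real K * (8 * (real n)\<^sup>2)"
    by (intro mult_left_mono) auto
  moreover define q where "q = Suc n * Suc n"
  have "real (Suc n) * real (Suc n) \<le> (2 * real n) * (2 * real n)"
    using n by (intro mult_mono) auto
  then have "real q \<le> 4 * (real n)\<^sup>2"
    by (simp only: q_def of_nat_mult power2_eq_square)
  then have "real M * real q \<le> real M * (4 * (real n)\<^sup>2)"
    by (intro mult_left_mono) auto
  moreover have "1 \<le> (real n)\<^sup>2" using n by simp
  ultimately show "real (K * (Suc n * Suc (loglen n)) + Suc (M * (Suc n * Suc n)))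
      \<le> (8 * real K + 4 * real M + 1) * (real n)\<^sup>2"
    unfolding t_def[symmetric] q_def[symmetric] by (simp add: distrib_right)
qed

lemma time_O_mono:
  assumes "time_O T f" "f \<in> O(g)"
  shows "time_O T g"
  using assms landau_o.big_trans unfolding time_O_def by blast

section \<open>The algorithms\<close>

lemma sorted_order_cong:
  "(\<And>i. i \<in> A \<Longrightarrow> x i = y i) \<Longrightarrow> sorted_order A x js \<longleftrightarrow> sorted_order A y js"
  unfolding sorted_order_def by (metis map_cong)

lemma written_merge_sort:
  "written (merge_sort a) = {''len'', ''i'', ''i1'', ''j'', ''j1'', ''k'', ''q'', ''p'', ''w''}"
  by (auto simp: merge_sort_def written_merge_pass)

lemma merge_sort_init:
  "runs_within (merge_sort a) (init n v x) (400 * (Suc n * Suc (loglen n)))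
    (\<lambda>t. \<exists>js. sorted_order {Suc a..n} x js \<and> holds_order js t
        \<and> ivar t ''len'' = n - a \<and> length js = n - a)"
proof -
  have "sorted_order {Suc a..n} (rarr (init n v x) ''x'') js \<longleftrightarrow> sorted_order {Suc a..n} x js" for js
    by (rule sorted_order_cong) (simp add: init_simps)
  moreover have "ivar (init n v x) ''n'' = n" by (simp add: init_simps)
  ultimately show ?thesis
    using merge_sort_correct[OF _ le_power_loglen, of "init n v x" n a] by simp
qed

definition perm_algorithm :: com where
  "perm_algorithm = Seq (merge_sort 2) prefix_scan"

lemma perm_algorithm_correct:
  "runs_within perm_algorithm (init n v x) (500 * (Suc n * Suc (loglen n)))
    (\<lambda>t. \<exists>js. sorted_order {3..n} x js \<and> result n ''out'' t = first_failure v x js)"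
  unfolding perm_algorithm_def
proof (rule runs_within_Seq[OF merge_sort_init])
  fix s assume s: "\<exists>js. sorted_order {Suc 2..n} x js \<and> holds_order js s \<and>
      ivar s ''len'' = n - 2 \<and> length js = n - 2" "agree (written (merge_sort 2)) (init n v x) s"
  then obtain js where js: "sorted_order {3..n} x js" "holds_order js s" "ivar s ''len'' = length js"
    by auto
  have "runs_within prefix_scan s (100 * Suc n) (\<lambda>t. result n ''out'' t = first_failure v x js)"
    using s(2) by (intro prefix_scan_correct[OF js]) (simp_all add: agree_def written_merge_sort init_simps)
  then show "runs_within prefix_scan s (100 * Suc n)
      (\<lambda>t. \<exists>js. sorted_order {3..n} x js \<and> result n ''out'' t = first_failure v x js)"
    using js(1) by (elim runs_within_mono) auto
qed simp

lemma perm_algorithm_separates: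
  "separates adm P perm_algorithm (\<lambda>n. 500 * (Suc n * Suc (loglen n)))"
  unfolding separates_def
proof (intro allI impI)
  fix n v x
  show "runs_within perm_algorithm (init n v x) (500 * (Suc n * Suc (loglen n)))
      (\<lambda>s. correct_answer n x (P n v) (result n ''out'' s))"
    using first_failure_correct
    by (intro runs_within_mono[OF perm_algorithm_correct order_refl]) metis
qed

definition level_algorithm :: "(string \<times> shape) list \<Rightarrow> com" where
  "level_algorithm ys = Seq (merge_sort 0) (level_loops ys)"

lemma level_algorithm_correct:
  assumes ys: "distinct (map fst ys)"
    "\<forall>(y, sh)\<in>set ys. y \<notin> reserved \<union> written (merge_sort 0) \<and> 2 \<le> lowest sh"
  shows "runs_within (level_algorithm ys) (init n v x)
    (400 * (Suc n * Suc (loglen n)) + Suc (400 * length ys * (Suc n * Suc n)))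
    (\<lambda>t. \<forall>(y, sh)\<in>set ys. correct_answer n x (shape_family sh n) (result n y t))"
  unfolding level_algorithm_def
proof (rule runs_within_Seq[OF merge_sort_init])
  fix s assume s: "\<exists>js. sorted_order {Suc 0..n} x js \<and> holds_order js s \<and>
      ivar s ''len'' = n - 0 \<and> length js = n - 0" "agree (written (merge_sort 0)) (init n v x) s"
  then obtain js where js: "sorted_order {1..n} x js" "holds_order js s"
    by auto
  have "\<forall>y\<in>fst ` set ys. ivar s y = 0"
  proof
    fix y assume "y \<in> fst ` set ys"
    then have "y \<notin> reserved \<union> written (merge_sort 0)" using ys(2) by auto
    then show "ivar s y = 0"
      using s(2) by (auto simp: agree_def init_simps reserved_def)
  qed
  moreover have "ivar s ''n'' = n" "rarr s ''x'' = (\<lambda>i. if i \<in> {1..n} then x i else 0)"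
    using s(2) by (auto simp: agree_def written_merge_sort init_simps)
  ultimately show "runs_within (level_loops ys) s (Suc (400 * length ys * (Suc n * Suc n)))
      (\<lambda>t. \<forall>(y, sh)\<in>set ys. correct_answer n x (shape_family sh n) (result n y t))"
    using ys js by (intro level_loops_correct) auto
qed simp

lemma shape_poly_separable:
  assumes F: "\<And>n v. F n v = shape_family sh n" and low: "2 \<le> lowest sh"
  shows "poly_separable adm F"
proof -
  have "runs_within (level_algorithm [(''out'', sh)]) (init n v x)
    (400 * (Suc n * Suc (loglen n)) + Suc (400 * (Suc n * Suc n)))
    (\<lambda>t. correct_answer n x (F n v) (result n ''out'' t))" for n v x
    using level_algorithm_correct[of "[(''out'', sh)]" n v x] low
    by (simp add: F reserved_def written_merge_sort)
  then show ?thesis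
    unfolding poly_separable_def separates_def using time_O_quadratic[of 400 400] by blast
qed

definition all_levels :: "(string \<times> shape) list" where
  "all_levels = map (\<lambda>t. (slot t, level_shape t)) [L1a, L1b, L2a, L2b, L2c, L2d, L2e]"

lemma all_levels_separates:
  "separates_levels (level_algorithm all_levels)
    (\<lambda>n. 400 * (Suc n * Suc (loglen n)) + Suc (2800 * (Suc n * Suc n)))"
  unfolding separates_levels_def
proof (intro allI impI)
  fix n v x
  have types: "set [L1a, L1b, L2a, L2b, L2c, L2d, L2e] = UNIV"
    using ltype.exhaust by auto
  have set: "set all_levels = (\<lambda>t. (slot t, level_shape t)) ` UNIV"
    unfolding all_levels_def set_map types ..
  have fresh: "slot t \<notin> reserved \<union> written (merge_sort 0)" for t
    by (cases t) (simp_all add: reserved_def written_merge_sort)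
  have "distinct (map fst all_levels)" by (simp add: all_levels_def)
  then have "runs_within (level_algorithm all_levels) (init n v x)
    (400 * (Suc n * Suc (loglen n)) + Suc (400 * length all_levels * (Suc n * Suc n)))
    (\<lambda>t. \<forall>(y, sh)\<in>set all_levels. correct_answer n x (shape_family sh n) (result n y t))"
    using fresh lowest_level_shape by (intro level_algorithm_correct) (auto simp: set)
  then show "runs_within (level_algorithm all_levels) (init n v x)
    (400 * (Suc n * Suc (loglen n)) + Suc (2800 * (Suc n * Suc n)))
    (\<lambda>s. \<forall>t. correct_answer n x (level_family t n v) (result n (slot t) s))"
    by (elim runs_within_mono) (simp_all add: set level_family_shape, simp add: all_levels_def)
qed

lemma level_step_separates_sorted:
  "separates_sorted t (level_step ''out'' (level_shape t)) (\<lambda>n. 300 * Suc n)"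
  unfolding separates_sorted_def
proof (intro allI impI)
  fix n v x js m
  assume "standard n v \<and> sorted_order {1..n} x js \<and> m \<in> m_range t n"
  then have js: "sorted_order {1..n} x js" and m: "m \<in> shape_range (level_shape t) n"
    by (simp_all add: m_range_shape)
  let ?s = "init_sorted n v x js m"
  have "length js = n" using js distinct_card[of js] by (simp add: sorted_order_def)
  then have "holds_order js ?s" by (simp add: holds_order_def init_sorted_def)
  moreover have "2 \<le> m" "m \<le> n" using m lowest_level_shape[of t] by (auto simp: shape_range_def)
  ultimately show "runs_within (level_step ''out'' (level_shape t)) ?s (300 * Suc n)
      (\<lambda>s. correct_answer n x (level_ineqs t n m) (result n ''out'' s))"
    unfolding level_ineqs_shape using js
    by (intro level_step_correct) (simp_all add: init_sorted_def init_def reserved_def)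
qed

lemma merge_sort_sorts: "sorts (merge_sort 0) (\<lambda>n. 400 * (Suc n * Suc (loglen n)))"
  unfolding sorts_def
proof (intro allI impI)
  fix n v x
  show "runs_within (merge_sort 0) (init n v x) (400 * (Suc n * Suc (loglen n)))
      (\<lambda>s. \<exists>js. sorted_order {1..n} x js \<and> holds_order js s)"
    by (rule runs_within_mono[OF merge_sort_init order_refl]) auto
qed

lemma perm_ineq_in_P:
  assumes "standard n v" "J \<subseteq> {3..n}" "card J = m" "1 \<le> m"
    "c = (\<lambda>k. of_bool (k \<in> J))" "\<alpha> = 1/2 * real m * (real m + 1)"
  shows "Ineq c Ge \<alpha> \<in> P n v"
proof -
  have "card J \<le> card {3..n}" using assms(2) by (intro card_mono) auto
  then have "m \<le> n" using assms(3) by simp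
  then have "Ineq c Ge \<alpha> = perm_ineq v J"
    using sum_standard[OF assms(1), of m] assms(3,5,6) by (simp only: perm_ineq_def)
  moreover have "J \<noteq> {}" using assms(3,4) by auto
  ultimately show ?thesis using assms(2) unfolding P_def by blast
qed

lemma subfamilies_of_P:
  assumes v: "standard n v" and F: "F \<in> {L0, level_family L1a, level_family L2a}"
  shows "F n v \<subseteq> P n v"
proof -
  have "L0 n v \<subseteq> P n v"
  proof
    fix I assume "I \<in> L0 n v"
    then obtain m J where "I = Ineq (\<lambda>k. of_bool (k \<in> J)) Ge (1/2 * real m * (real m + 1))"
      "m \<in> {2..n}" "J \<subseteq> {m+1..n}" "card J = m" by (auto simp: L0_def)
    moreover from this have "J \<subseteq> {3..n}" by fastforce
    ultimately show "I \<in> P n v" by (auto intro: perm_ineq_in_P[OF v])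
  qed
  moreover have "level_family L1a n v \<subseteq> P n v"
  proof
    fix I assume "I \<in> level_family L1a n v"
    then obtain m K where m: "m \<in> m_range L1a n" and K: "K \<subseteq> {m+1..n}" "card K = m - 1"
      and I: "I = Ineq (\<lambda>k. of_bool (k = m) + 1 * of_bool (k \<in> K)) Ge (1/2 * real m * (real m + 1))"
      by (auto simp: level_family_def level1_ineqs_def)
    have "3 \<le> m" "m \<le> n" using m by (auto simp: m_range_def)
    have "finite K" using K(1) finite_subset by blast
    moreover have "m \<notin> K" using K(1) by auto
    ultimately have "card (insert m K) = m" using K(2) \<open>3 \<le> m\<close> by simp
    moreover have "insert m K \<subseteq> {3..n}" using K(1) \<open>3 \<le> m\<close> \<open>m \<le> n\<close> by auto
    moreover have "(\<lambda>k. of_bool (k = m) + 1 * of_bool (k \<in> K)) = (\<lambda>k. of_bool (k \<in> insert m K) :: real)"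
      using \<open>m \<notin> K\<close> by auto
    ultimately show "I \<in> P n v"
      using \<open>3 \<le> m\<close> unfolding I by (intro perm_ineq_in_P[OF v]) auto
  qed
  moreover have "level_family L2a n v \<subseteq> P n v"
  proof
    fix I assume "I \<in> level_family L2a n v"
    then obtain m L where m: "m \<in> m_range L2a n" and L: "L \<subseteq> {m+1..n}" "card L = m - 2"
      and I: "I = Ineq (\<lambda>k. 1 * of_bool (k = m - 1) + 1 * of_bool (k = m) + 1 * of_bool (k \<in> L)) Ge
        (1/2 * real m * (real m + 1))"
      by (auto simp: level_family_def level2_ineqs_def)
    have "4 \<le> m" "m \<le> n" using m by (auto simp: m_range_def)
    let ?J = "insert (m - 1) (insert m L)"
    have "finite L" using L(1) finite_subset by blast
    moreover have new: "m \<notin> L" "m - 1 \<notin> L" using L(1) by (auto dest!: subsetD)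
    ultimately have "card ?J = m" using L(2) \<open>4 \<le> m\<close> by simp
    moreover have "?J \<subseteq> {3..n}" using L(1) \<open>4 \<le> m\<close> \<open>m \<le> n\<close> by auto
    moreover have "(\<lambda>k. 1 * of_bool (k = m - 1) + 1 * of_bool (k = m) + 1 * of_bool (k \<in> L))
        = (\<lambda>k. of_bool (k \<in> ?J) :: real)"
      using new \<open>4 \<le> m\<close> by (auto simp: of_bool_def fun_eq_iff)
    ultimately show "I \<in> P n v"
      using \<open>4 \<le> m\<close> unfolding I by (intro perm_ineq_in_P[OF v]) auto
  qed
  ultimately show ?thesis using F by blast
qed

lemma poly_separableI:
  assumes "time_O T (\<lambda>n. real n ^ d)" "separates adm F c T"
  shows "poly_separable adm F"
  unfolding poly_separable_def using assms by (intro exI conjI)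

lemma perm_algorithm_reports:
  assumes v: "standard n v" and F: "F n v \<subseteq> P n v" and viol: "\<exists>I\<in>F n v. violated n I x"
  shows "runs_within perm_algorithm (init n v x) (500 * (Suc n * Suc (loglen n)))
    (\<lambda>s. \<exists>I\<in>P n v. result n ''out'' s = Some I \<and> violated n I x)"
proof -
  have ex: "\<exists>I\<in>P n v. violated n I x" using F viol by blast
  have "runs_within perm_algorithm (init n v x) (500 * (Suc n * Suc (loglen n)))
      (\<lambda>s. correct_answer n x (P n v) (result n ''out'' s))"
    using perm_algorithm_separates[of standard] v unfolding separates_def by blast
  then show ?thesis
  proof (rule runs_within_mono[OF _ order_refl])
    fix s assume "correct_answer n x (P n v) (result n ''out'' s)"
    then show "\<exists>I\<in>P n v. result n ''out'' s = Some I \<and> violated n I x"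
      using ex by (cases "result n ''out'' s") (auto simp: correct_answer_def)
  qed
qed

lemma perm_algorithm_standard:
  assumes v: "standard n v"
  shows "runs_within perm_algorithm (init n v x) (500 * (Suc n * Suc (loglen n)))
    (\<lambda>s. \<exists>js. sorted_order {3..n} x js \<and> result n ''out'' s = successive_check x js)"
proof (rule runs_within_mono[OF perm_algorithm_correct order_refl])
  fix s assume "\<exists>js. sorted_order {3..n} x js \<and> result n ''out'' s = first_failure v x js"
  then obtain js where js: "sorted_order {3..n} x js" "result n ''out'' s = first_failure v x js"
    by blast
  have "length js \<le> n" using js(1) distinct_card[of js] by (simp add: sorted_order_def)
  with js first_failure_standard[OF v]
  show "\<exists>js. sorted_order {3..n} x js \<and> result n ''out'' s = successive_check x js" by metis
qed

theorem mainTheorem11: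
  shows
    "poly_separable general P
     \<and> (\<forall>F \<in> {T1, T2, T3, T4, T5}. poly_separable general6 F)
     \<and> poly_separable standard L0
     \<and> (\<forall>t. poly_separable standard (level_family t))
     \<and> (\<exists>c T. time_O T (\<lambda>n. real n * ln (real n))
          \<and> separates standard P c T
          \<and> (\<forall>n v x. standard n v \<longrightarrow>
               runs_within c (init n v x) (T n)
                 (\<lambda>s. \<exists>js. sorted_order {3..n} x js \<and> result n ''out'' s = successive_check x js))
          \<and> (\<forall>F \<in> {L0, level_family L1a, level_family L2a}. \<forall>n v x. standard n v \<longrightarrow>
               F n v \<subseteq> P n v
               \<and> ((\<exists>I\<in>F n v. violated n I x) \<longrightarrow>
                    runs_within c (init n v x) (T n)
                      (\<lambda>s. \<exists>I\<in>P n v. result n ''out'' s = Some I \<and> violated n I x))))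
     \<and> (\<forall>n v x js m. standard n v \<and> sorted_order {3..n} x js
          \<and> (\<exists>J. J \<noteq> {} \<and> J \<subseteq> {3..n} \<and> card J = m \<and> violated n (perm_ineq v J) x)
          \<longrightarrow> violated n (perm_ineq v (set (take m js))) x)
     \<and> (\<forall>F \<in> {T1, T2, T3, T4}. \<exists>c T. time_O T (\<lambda>n. real n) \<and> separates general6 F c T)
     \<and> (\<forall>t \<in> {L1b, L2b, L2c, L2d, L2e}.
          \<exists>c T. time_O T (\<lambda>n. real n) \<and> separates_sorted t c T)
     \<and> (\<exists>c d T\<^sub>c T. time_O T\<^sub>c (\<lambda>n. real n * ln (real n)) \<and> sorts c T\<^sub>c
          \<and> time_O T (\<lambda>n. real n * ln (real n) + (real n)\<^sup>2) \<and> time_O T (\<lambda>n. (real n)\<^sup>2)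
          \<and> separates_levels (Seq c d) T)"
proof (intro conjI)
  let ?T = "\<lambda>n. 500 * (Suc n * Suc (loglen n))"
  have T: "time_O ?T (\<lambda>n. real n * ln (real n))" by (rule time_O_n_ln_n)
  have n_ln_n: "(\<lambda>n. real n * ln (real n)) \<in> O(\<lambda>n. real n ^ 2)"
    by (rule bigoI[where c = 1], rule eventually_sequentiallyI[where c = 1])
      (use ln_bound in \<open>simp add: power2_eq_square abs_mult\<close>)
  show "poly_separable general P"
    by (rule poly_separableI[OF time_O_mono[OF T n_ln_n] perm_algorithm_separates])
  have linear: "\<forall>F\<in>{T1, T2, T3, T4, T5}. \<exists>c T. time_O T (\<lambda>n. real n) \<and> separates general6 F c T"
    using T1_linear T2_linear T3_linear T4_linear T5_linear by simp
  show "\<forall>F\<in>{T1, T2, T3, T4, T5}. poly_separable general6 F"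
  proof
    fix F assume "F \<in> {T1, T2, T3, T4, T5}"
    with linear obtain c T where "time_O T (\<lambda>n. real n)" "separates general6 F c T" by blast
    then show "poly_separable general6 F" by (intro poly_separableI[where d = 1]) simp_all
  qed
  from linear show "\<forall>F\<in>{T1, T2, T3, T4}. \<exists>c T. time_O T (\<lambda>n. real n) \<and> separates general6 F c T"
    by blast
  show "poly_separable standard L0"
    by (rule shape_poly_separable[OF L0_shape]) (simp add: level0_shape_def)
  show "\<forall>t. poly_separable standard (level_family t)"
    by (intro allI shape_poly_separable[OF level_family_shape lowest_level_shape])
  show "\<exists>c T. time_O T (\<lambda>n. real n * ln (real n))
          \<and> separates standard P c T
          \<and> (\<forall>n v x. standard n v \<longrightarrow>
               runs_within c (init n v x) (T n)
                 (\<lambda>s. \<exists>js. sorted_order {3..n} x js \<and> result n ''out'' s = successive_check x js))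
          \<and> (\<forall>F \<in> {L0, level_family L1a, level_family L2a}. \<forall>n v x. standard n v \<longrightarrow>
               F n v \<subseteq> P n v
               \<and> ((\<exists>I\<in>F n v. violated n I x) \<longrightarrow>
                    runs_within c (init n v x) (T n)
                      (\<lambda>s. \<exists>I\<in>P n v. result n ''out'' s = Some I \<and> violated n I x)))"
  proof (intro exI[of _ perm_algorithm] exI[of _ ?T] conjI ballI allI impI T
      perm_algorithm_separates perm_algorithm_standard)
    fix F :: family and n v x
    assume F: "F \<in> {L0, level_family L1a, level_family L2a}" and v: "standard n v"
    show sub: "F n v \<subseteq> P n v" by (rule subfamilies_of_P[OF v F])
    assume "\<exists>I\<in>F n v. violated n I x"
    then show "runs_within perm_algorithm (init n v x) (?T n)
        (\<lambda>s. \<exists>I\<in>P n v. result n ''out'' s = Some I \<and> violated n I x)"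
      by (rule perm_algorithm_reports[where F = F, OF v sub])
  qed
  show "\<forall>n v x js m. standard n v \<and> sorted_order {3..n} x js
          \<and> (\<exists>J. J \<noteq> {} \<and> J \<subseteq> {3..n} \<and> card J = m \<and> violated n (perm_ineq v J) x)
          \<longrightarrow> violated n (perm_ineq v (set (take m js))) x"
    using violated_imp_prefix_violated(2) by blast
  show "\<forall>t\<in>{L1b, L2b, L2c, L2d, L2e}.
          \<exists>c T. time_O T (\<lambda>n. real n) \<and> separates_sorted t c T"
  proof
    fix t
    have "time_O (\<lambda>n. 300 * Suc n) (\<lambda>n. real n)" by (rule time_O_linear)
    then show "\<exists>c T. time_O T (\<lambda>n. real n) \<and> separates_sorted t c T"
      using level_step_separates_sorted[of t] by (intro exI conjI)
  qed
  have Q: "time_O (\<lambda>n. 400 * (Suc n * Suc (loglen n)) + Suc (2800 * (Suc n * Suc n))) (\<lambda>n. (real n)\<^sup>2)"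
    by (rule time_O_quadratic)
  have sum: "(\<lambda>n. (real n)\<^sup>2) \<in> O(\<lambda>n. real n * ln (real n) + (real n)\<^sup>2)"
    by (rule bigoI[where c = 1], rule eventually_sequentiallyI[where c = 1]) simp
  show "\<exists>c d T\<^sub>c T. time_O T\<^sub>c (\<lambda>n. real n * ln (real n)) \<and> sorts c T\<^sub>c
          \<and> time_O T (\<lambda>n. real n * ln (real n) + (real n)\<^sup>2) \<and> time_O T (\<lambda>n. (real n)\<^sup>2)
          \<and> separates_levels (Seq c d) T"
    using time_O_n_ln_n[of 400] merge_sort_sorts time_O_mono[OF Q sum] Q
      all_levels_separates[unfolded level_algorithm_def] by (intro exI conjI)
qed

end
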